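(* Let $d\ge1$, $L_1,\dots,L_d\ge1$ be integers and $\Lambda=\{1,\dots,L_1\}\times\cdots\times\{1,\dots,L_d\}$. For the Edwards–Anderson model with independent standard Gaussian couplings, the quenched surface pressure with free boundary conditions satisfies $$T^{(\Phi)}_\Lambda\;=\;-\frac{|\partial\Lambda|}{4}\lim_{k\to\infty}\int_0^1\Big(1-\big\langle q_{\partial B(\Lambda)}\big\rangle^{(\Pi_{k\Lambda})}_t\Big)\,dt ,$$ and in particular $\tau^{(\Phi)}_{\partial\Lambda}:=T^{(\Phi)}_\Lambda/|\partial\Lambda|$ satisfies $$-\frac14\;\le\;\tau^{(\Phi)}_{\partial\Lambda}\;\le\;0 .$$
   Context: Notation. $|\Lambda|=\prod_i L_i$ and $|\partial\Lambda|=2\sum_{i=1}^d\prod_{j\ne i}L_j$ is the surface of $\Lambda$. Spin configurations are $\sigma\in\{-1,1\}^{\Lambda}$. $B(\Lambda)$ is the set of nearest-neighbour bonds $b=\{n,n'\}\subset\Lambda$, $|n-n'|=1$, and $\sigma_b=\sigma_n\sigma_{n'}$. $(J_b)$ are i.i.d. standard Gaussian variables, $\mathrm{Av}$ the Gaussian expectation. Free boundary conditions: $Z^{(\Phi)}_\Lambda(J)=\sum_\sigma\exp\big(\sum_{b\in B(\Lambda)}J_b\sigma_b\big)$, quenched pressure $P^{(\Phi)}_\Lambda=\mathrm{Av}\ln Z^{(\Phi)}_\Lambda(J)$. The infinite-volume pressure $p=\lim |\Lambda'|^{-1}\mathrm{Av}\ln Z_{\Lambda'}$ (limit as all sides of the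 box $\Lambda'$ tend to infinity) is known to exist and not to depend on the (free or periodic) boundary conditions. The quenched surface pressure is $T^{(\Phi)}_\Lambda=P^{(\Phi)}_\Lambda-p|\Lambda|$. Tori. For a box $M=\prod_i\{1,\dots,M_i\}$, the torus $\Pi_M=\mathbb Z^d/(M_1\mathbb Z\times\cdots\times M_d\mathbb Z)$ has sites $M$ and bonds $b=(n,i)$, $n\in M$, $i\in\{1,\dots,d\}$, joining $n$ to $n+e_i$ (coordinates taken modulo $M_i$ in $\{1,\dots,M_i\}$); $\sigma_b=\sigma_n\sigma_{n+e_i}$. Define $\partial B(\Lambda)=\{(n,i):n\in\Lambda,\ n_i=L_i\}$, the torus bonds of $\Pi_\Lambda$ not in $B(\Lambda)$. Magnification. For a positive integer $k$, $k\Lambda=\prod_i\{1,\dots,kL_i\}$, partitioned into $k^d$ disjoint translates $\Lambda_s$ of $\Lambda$ (with $\Lambda_1=\Lambda$). Let $\mathcal C_{\Pi_{k\Lambda}}$ be the set of bonds of the torus $\Pi_{k\Lambda}$ not joining two sites of the same $\Lambda_s$ (i.e. bonds $(n,i)$ with $n_i\in L_i\mathbb Z$). For $t\in[0,1]$ consider on $\Pi_{k\Lambda}$ the potential $U_t(\sigma)=\sum_{b}\sqrt{t_b}J_b\sigma_b$, sum over all bonds of $\Pi_{k\Lambda}$, with $t_b=t$ if $b\in\mathcal C_{\Pi_{k\Lambda}}$ and $t_b=1$ otherwise. Its Gibbs state on pairs of configurations (two replicas, same $J$) is $\omega_t(g)=\sum_{\sigma,\tau}g(\sigma,\tau)e^{U_t(\sigma)+U_t(\tau)}/(\sum_\sigma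 e^{U_t(\sigma)})^2$ and the quenched state is $\langle\cdot\rangle^{(\Pi_{k\Lambda})}_t=\mathrm{Av}\,\omega_t(\cdot)$. The boundary bond overlap is $q_{\partial B(\Lambda)}(\sigma,\tau)=|\partial B(\Lambda)|^{-1}\sum_{b\in\partial B(\Lambda)}\sigma_b\tau_b$, where $\partial B(\Lambda)$ is viewed as the set of bonds $(n,i)$ of $\Pi_{k\Lambda}$ with $n\in\Lambda$, $n_i=L_i$. *)

theory Defs
  imports "HOL-Probability.Probability"
begin

text \<open>Sites are functions n :: nat => nat, with n i the i-th coordinate for i < d
  and n i = 0 for i >= d.  Bonds are pairs (n, i) with i < d.\<close>

type_synonym site = "nat \<Rightarrow> nat"
type_synonym bond = "site \<times> nat"

definition lat_box :: "nat \<Rightarrow> (nat \<Rightarrow> nat) \<Rightarrow> site set" where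
  "lat_box d L = {n. (\<forall>i<d. 1 \<le> n i \<and> n i \<le> L i) \<and> (\<forall>i\<ge>d. n i = 0)}"

definition surface :: "nat \<Rightarrow> (nat \<Rightarrow> nat) \<Rightarrow> nat" where
  "surface d L = 2 * (\<Sum>i<d. \<Prod>j\<in>{..<d} - {i}. L j)"

definition configs :: "site set \<Rightarrow> (site \<Rightarrow> real) set" where
  "configs S = S \<rightarrow>\<^sub>E {-1, 1}"

definition gauss_av :: "'b set \<Rightarrow> (('b \<Rightarrow> real) \<Rightarrow> real) \<Rightarrow> real" where
  "gauss_av I f = integral\<^sup>L (PiM I (\<lambda>_. density lborel std_normal_density)) f"

definition shift :: "site \<Rightarrow> nat \<Rightarrow> site" where
  "shift n i = n(i := n i + 1)"

text \<open>Nearest-neighbour bonds B(Lambda) of the box: (n,i) joins n and n+e_i, both in Lambda.\<close>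
definition free_bonds :: "nat \<Rightarrow> (nat \<Rightarrow> nat) \<Rightarrow> bond set" where
  "free_bonds d L = {(n, i). n \<in> lat_box d L \<and> i < d \<and> n i < L i}"

definition Z_free :: "nat \<Rightarrow> (nat \<Rightarrow> nat) \<Rightarrow> (bond \<Rightarrow> real) \<Rightarrow> real" where
  "Z_free d L J = (\<Sum>\<sigma>\<in>configs (lat_box d L).
      exp (\<Sum>b\<in>free_bonds d L. J b * \<sigma> (fst b) * \<sigma> (shift (fst b) (snd b))))"

definition P_free :: "nat \<Rightarrow> (nat \<Rightarrow> nat) \<Rightarrow> real" where
  "P_free d L = gauss_av (free_bonds d L) (\<lambda>J. ln (Z_free d L J))"

definition all_sides_to_infinity :: "nat \<Rightarrow> (nat \<Rightarrow> nat) filter" where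
  "all_sides_to_infinity d = (INF N. principal {L. \<forall>i<d. N \<le> L i})"

definition pressure :: "nat \<Rightarrow> real" where
  "pressure d = Lim (all_sides_to_infinity d)
      (\<lambda>L. P_free d L / real (card (lat_box d L)))"

definition surface_pressure :: "nat \<Rightarrow> (nat \<Rightarrow> nat) \<Rightarrow> real" where
  "surface_pressure d L = P_free d L - pressure d * real (card (lat_box d L))"

definition tshift :: "(nat \<Rightarrow> nat) \<Rightarrow> site \<Rightarrow> nat \<Rightarrow> site" where
  "tshift M n i = n(i := (if n i = M i then 1 else n i + 1))"

definition torus_bonds :: "nat \<Rightarrow> (nat \<Rightarrow> nat) \<Rightarrow> bond set" where
  "torus_bonds d M = {(n, i). n \<in> lat_box d M \<and> i < d}"

definition magnify :: "nat \<Rightarrow> (nat \<Rightarrow> nat) \<Rightarrow> (nat \<Rightarrow> nat)" where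
  "magnify k L = (\<lambda>i. k * L i)"

definition tweight :: "(nat \<Rightarrow> nat) \<Rightarrow> real \<Rightarrow> bond \<Rightarrow> real" where
  "tweight L t b = (if L (snd b) dvd fst b (snd b) then t else 1)"

definition U_t :: "nat \<Rightarrow> (nat \<Rightarrow> nat) \<Rightarrow> nat \<Rightarrow> real \<Rightarrow> (bond \<Rightarrow> real) \<Rightarrow> (site \<Rightarrow> real) \<Rightarrow> real" where
  "U_t d L k t J \<sigma> = (\<Sum>b\<in>torus_bonds d (magnify k L).
      sqrt (tweight L t b) * J b * \<sigma> (fst b) * \<sigma> (tshift (magnify k L) (fst b) (snd b)))"

definition omega_t :: "nat \<Rightarrow> (nat \<Rightarrow> nat) \<Rightarrow> nat \<Rightarrow> real \<Rightarrow> (bond \<Rightarrow> real)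
    \<Rightarrow> ((site \<Rightarrow> real) \<Rightarrow> (site \<Rightarrow> real) \<Rightarrow> real) \<Rightarrow> real" where
  "omega_t d L k t J g =
     (\<Sum>\<sigma>\<in>configs (lat_box d (magnify k L)). \<Sum>\<tau>\<in>configs (lat_box d (magnify k L)).
        g \<sigma> \<tau> * exp (U_t d L k t J \<sigma> + U_t d L k t J \<tau>))
     / (\<Sum>\<sigma>\<in>configs (lat_box d (magnify k L)). exp (U_t d L k t J \<sigma>))\<^sup>2"

definition quenched_t :: "nat \<Rightarrow> (nat \<Rightarrow> nat) \<Rightarrow> nat \<Rightarrow> real
    \<Rightarrow> ((site \<Rightarrow> real) \<Rightarrow> (site \<Rightarrow> real) \<Rightarrow> real) \<Rightarrow> real" where
  "quenched_t d L k t g = gauss_av (torus_bonds d (magnify k L)) (\<lambda>J. omega_t d L k t J g)"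

text \<open>dB(Lambda) = {(n,i). n in Lambda, n_i = L_i}, viewed as bonds of Pi_{k Lambda}.\<close>
definition bdry_bonds :: "nat \<Rightarrow> (nat \<Rightarrow> nat) \<Rightarrow> bond set" where
  "bdry_bonds d L = {(n, i). n \<in> lat_box d L \<and> i < d \<and> n i = L i}"

definition q_bdry :: "nat \<Rightarrow> (nat \<Rightarrow> nat) \<Rightarrow> nat \<Rightarrow> (site \<Rightarrow> real) \<Rightarrow> (site \<Rightarrow> real) \<Rightarrow> real" where
  "q_bdry d L k \<sigma> \<tau> = (\<Sum>b\<in>bdry_bonds d L.
      \<sigma> (fst b) * \<sigma> (tshift (magnify k L) (fst b) (snd b)) *
      \<tau> (fst b) * \<tau> (tshift (magnify k L) (fst b) (snd b))) / real (card (bdry_bonds d L))"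

end

theory Submission
  imports Defs "HOL-Real_Asymp.Real_Asymp"
begin

text \<open>Switching on the couplings across the block boundaries of the torus over $k\Lambda$ with
  weight $\sqrt t$, Gaussian integration by parts gives the $t$-derivative of the quenched pressure
  as $\frac12 \sum_b (1 - \langle q_b \rangle_t)$ over these bonds, and by translation invariance
  the sum is $k^d$ times the sum over $\partial B(\Lambda)$. At $t = 0$ the pressure is $k^d$ times
  that of $\Lambda$ with free boundary, at $t = 1$ it is the pressure of the torus, which divided
  by $k^d$ tends to $p |\Lambda|$. Every $\langle q_b \rangle_t$ is the average of a squared
  one-replica expectation, hence lies in $[0, 1]$.

  The same interpolation bounds the difference between the pressure of a torus and that of its
  blocks by half the number of cut bonds. Comparing two boxes with the torus that both of them tile
  makes the free pressure density Cauchy, so the infinite-volume limit exists.\<close>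

subsection \<open>Gaussian averages\<close>

text \<open>The constant 1/4 combines the 1/2 of the interpolation formula with
  \<open>surface\<close>, which counts both faces in each direction and so is twice the number of
  bonds in \<open>bdry_bonds\<close>. Two obstacles shape the proof. The square root of t is not
  differentiable at 0, so derivatives are taken in r, the square root of t, in which the couplings
  are affine. And \<open>pressure\<close> is a \<open>Lim\<close> over free boxes, while the
  interpolation ends on tori, so the limit must exist along the filter and be transferred to tori.
  One estimate serves both: the error per site between a torus and its free blocks is bounded in
  terms of the block sides alone, however many blocks there are. Taking a single block compares a
  torus with the free box of the same size. Translation invariance is partial. The weights of the
  interpolated torus are preserved by block translations, not by arbitrary ones, which is just
  enough to reduce all cut bonds to those of one block.\<close>

abbreviation std_gauss :: "real measure" where
  "std_gauss \<equiv> density lborel std_normal_density"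

abbreviation gauss_prod :: "'b set \<Rightarrow> ('b \<Rightarrow> real) measure" where
  "gauss_prod I \<equiv> PiM I (\<lambda>_. std_gauss)"

lemma prob_space_std_gauss: "prob_space std_gauss"
  by (rule prob_space_normal_density) simp

lemma prob_space_gauss_prod: "prob_space (gauss_prod I)"
  by (intro prob_space_PiM prob_space_std_gauss)

lemma integrable_abs_std_gauss: "integrable std_gauss (\<lambda>x. \<bar>x\<bar>)"
  using integrable_std_normal_moment_abs[of 1]
  by (subst integrable_real_density) (auto simp: normal_density_nonneg)

lemma measurable_gauss_component:
  "b \<in> I \<Longrightarrow> (\<lambda>J. J b) \<in> borel_measurable (gauss_prod I)"
  using measurable_component_singleton[of b I "\<lambda>_. std_gauss"] by simp

lemma integrable_abs_gauss_component:
  assumes "b \<in> I"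
  shows "integrable (gauss_prod I) (\<lambda>J. \<bar>J b\<bar>)"
proof -
  have "distr (gauss_prod I) std_gauss (\<lambda>J. J b) = std_gauss"
    using assms by (intro distr_PiM_component prob_space_std_gauss)
  then have "integrable (distr (gauss_prod I) std_gauss (\<lambda>J. J b)) (\<lambda>x. \<bar>x\<bar>)"
    by (simp only: integrable_abs_std_gauss)
  then show ?thesis
    by (subst (asm) integrable_distr_eq) (use assms in \<open>auto intro: measurable_component_singleton\<close>)
qed

lemma integrable_gauss_bounded:
  assumes "f \<in> borel_measurable (gauss_prod I)" "\<And>J. \<bar>f J\<bar> \<le> (K::real)"
  shows "integrable (gauss_prod I) f"
proof -
  interpret prob_space "gauss_prod I" by (rule prob_space_gauss_prod)
  show ?thesis
    by (rule integrable_const_bound[of _ K]) (use assms in auto)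
qed

section \<open>Transport of Gaussian averages between index sets\<close>

context
  fixes f :: "'a \<Rightarrow> 'b" and I :: "'a set" and K :: "'b set"
  assumes inj: "inj_on f I" and maps: "f \<in> I \<rightarrow> K"
begin

text \<open>Couplings read off along an injection are again i.i.d. Gaussians. The injections used
  later embed the bonds of a block into the torus or permute the torus bonds.\<close>

lemma distr_gauss_reindex:
  "distr (gauss_prod K) (gauss_prod I) (\<lambda>J. \<lambda>n\<in>I. J (f n)) = gauss_prod I"
  using distr_PiM_reindex[of K "\<lambda>_. std_gauss" f I] inj maps
  by (simp add: prob_space_std_gauss)

lemma measurable_gauss_reindex:
  "(\<lambda>J. \<lambda>n\<in>I. J (f n)) \<in> gauss_prod K \<rightarrow>\<^sub>M gauss_prod I"
  using maps by (intro measurable_restrict measurable_component_singleton) auto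

lemma gauss_av_reindex:
  assumes "h \<in> borel_measurable (gauss_prod I)"
  shows "gauss_av K (\<lambda>J. h (\<lambda>n\<in>I. J (f n))) = gauss_av I h"
  using integral_distr[OF measurable_gauss_reindex assms]
  by (simp add: distr_gauss_reindex gauss_av_def)

lemma integrable_gauss_reindex:
  assumes "integrable (gauss_prod I) (h :: _ \<Rightarrow> real)"
  shows "integrable (gauss_prod K) (\<lambda>J. h (\<lambda>n\<in>I. J (f n)))"
  by (rule integrable_distr[OF measurable_gauss_reindex]) (simp add: distr_gauss_reindex assms)

end

text \<open>Dominated convergence for the difference quotients along sequences: \<open>g\<close>
  bounds the derivative for all \<open>r\<close> at once, so the mean value inequality bounds every
  quotient by \<open>g\<close>.\<close>

lemma has_real_derivative_integral:
  fixes f f' :: "real \<Rightarrow> 'a \<Rightarrow> real"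
  assumes int: "\<And>r. integrable M (f r)"
    and der: "\<And>r x. ((\<lambda>r. f r x) has_real_derivative f' r x) (at r)"
    and meas: "f' r \<in> borel_measurable M"
    and bound: "\<And>r x. \<bar>f' r x\<bar> \<le> g x" and g: "integrable M g"
  shows "((\<lambda>r. integral\<^sup>L M (f r)) has_real_derivative integral\<^sup>L M (f' r)) (at r)"
  unfolding DERIV_def tendsto_at_iff_sequentially comp_def
proof (intro allI impI)
  fix X :: "nat \<Rightarrow> real"
  assume X: "\<forall>i. X i \<in> UNIV - {0}" "X \<longlonglongrightarrow> 0"
  have "(\<lambda>n. integral\<^sup>L M (\<lambda>x. (f (r + X n) x - f r x) / X n)) \<longlonglongrightarrow> integral\<^sup>L M (f' r)"
  proof (rule integral_dominated_convergence[where w = g])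
    show "AE x in M. (\<lambda>n. (f (r + X n) x - f r x) / X n) \<longlonglongrightarrow> f' r x"
    proof (rule AE_I2)
      fix x
      have "((\<lambda>h. (f (r + h) x - f r x) / h) \<longlongrightarrow> f' r x) (at 0)"
        using der[of x r] by (simp add: DERIV_def)
      then show "(\<lambda>n. (f (r + X n) x - f r x) / X n) \<longlonglongrightarrow> f' r x"
        using X by (auto simp: tendsto_at_iff_sequentially comp_def)
    qed
    show "AE x in M. norm ((f (r + X n) x - f r x) / X n) \<le> g x" for n
    proof (rule AE_I2)
      fix x
      have "norm (f (r + X n) x - f r x) \<le> g x * norm (r + X n - r)"
        using der[of x] bound
        by (intro field_differentiable_bound[of UNIV "\<lambda>r. f r x" "\<lambda>r. f' r x"])
           (auto intro: has_field_derivative_at_within)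
      then show "norm ((f (r + X n) x - f r x) / X n) \<le> g x"
        using X(1) by (auto simp: field_simps abs_mult)
    qed
  qed (use int meas g in auto)
  moreover have "integral\<^sup>L M (\<lambda>x. (f (r + X n) x - f r x) / X n)
      = (integral\<^sup>L M (f (r + X n)) - integral\<^sup>L M (f r)) / X n" for n
    by (simp add: int Bochner_Integration.integral_diff del: divide_cancel_right)
  ultimately show "(\<lambda>n. (integral\<^sup>L M (f (r + X n)) - integral\<^sup>L M (f r)) / X n)
      \<longlonglongrightarrow> integral\<^sup>L M (f' r)"
    by (simp only:)
qed

section \<open>Gaussian integration by parts\<close>

lemma std_normal_density_at_top: "(std_normal_density \<longlongrightarrow> 0) at_top"
  and std_normal_density_at_bot: "(std_normal_density \<longlongrightarrow> 0) at_bot"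
  unfolding std_normal_density_def by real_asymp+

text \<open>The fundamental theorem on the whole line for the product of \<open>\<phi>\<close> and
  the density. Boundedness of \<open>\<phi>\<close> kills the boundary terms and, with that of
  \<open>\<phi>'\<close>, gives integrability.\<close>

lemma std_gauss_integration_by_parts:
  fixes \<phi> \<phi>' :: "real \<Rightarrow> real"
  assumes der: "\<And>x. (\<phi> has_real_derivative \<phi>' x) (at x)"
    and cont: "\<And>x. isCont \<phi>' x"
    and bound: "\<And>x. \<bar>\<phi> x\<bar> \<le> A" "\<And>x. \<bar>\<phi>' x\<bar> \<le> A'"
  shows "(\<integral>x. x * \<phi> x \<partial>std_gauss) = (\<integral>x. \<phi>' x \<partial>std_gauss)"
proof -
  define F where "F = (\<lambda>x. - (\<phi> x * std_normal_density x))"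
  let ?f1 = "\<lambda>x. std_normal_density x * (x * \<phi> x)"
  let ?f2 = "\<lambda>x. std_normal_density x * \<phi>' x"
  have cont\<phi>: "isCont \<phi> x" for x
    using der DERIV_isCont by blast
  have meas: "\<phi> \<in> borel_measurable borel" "\<phi>' \<in> borel_measurable borel"
    by (rule borel_measurable_continuous_onI, rule continuous_at_imp_continuous_on, simp add: cont\<phi> cont)+
  have contd: "isCont std_normal_density x" for x
    unfolding std_normal_density_def by (intro continuous_intros) auto
  have int1: "integrable lborel ?f1"
  proof (rule Bochner_Integration.integrable_bound)
    show "integrable lborel (\<lambda>x. A * (std_normal_density x * \<bar>x\<bar> ^ 1))"
      by (intro integrable_mult_right integrable_std_normal_moment_abs)
    show "AE x in lborel. norm (?f1 x) \<le> norm (A * (std_normal_density x * \<bar>x\<bar> ^ 1))"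
    proof (rule AE_I2)
      fix x
      have "(\<bar>x\<bar> * std_normal_density x) * \<bar>\<phi> x\<bar> \<le> (\<bar>x\<bar> * std_normal_density x) * \<bar>A\<bar>"
        using bound(1)[of x] by (intro mult_left_mono) (auto simp: normal_density_nonneg)
      then show "norm (?f1 x) \<le> norm (A * (std_normal_density x * \<bar>x\<bar> ^ 1))"
        by (simp add: abs_mult mult_ac)
    qed
  qed (use meas in \<open>simp add: borel_measurable_times\<close>)
  have int2: "integrable lborel ?f2"
  proof (rule Bochner_Integration.integrable_bound)
    show "integrable lborel (\<lambda>x. A' * (std_normal_density x * \<bar>x\<bar> ^ 0))"
      by (intro integrable_mult_right integrable_std_normal_moment_abs)
    show "AE x in lborel. norm (?f2 x) \<le> norm (A' * (std_normal_density x * \<bar>x\<bar> ^ 0))"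
    proof (rule AE_I2)
      fix x
      have "std_normal_density x * \<bar>\<phi>' x\<bar> \<le> std_normal_density x * \<bar>A'\<bar>"
        using bound(2)[of x] by (intro mult_left_mono) auto
      then show "norm (?f2 x) \<le> norm (A' * (std_normal_density x * \<bar>x\<bar> ^ 0))"
        by (simp add: abs_mult mult_ac)
    qed
  qed (use meas in \<open>simp add: borel_measurable_times\<close>)
  have derd: "(std_normal_density has_real_derivative - x * std_normal_density x) (at x)" for x
    unfolding std_normal_density_def
    by (auto intro!: derivative_eq_intros simp: field_simps)
  have lim: "(F \<longlongrightarrow> 0) G" if "(std_normal_density \<longlongrightarrow> 0) G" for G
  proof (rule Lim_null_comparison)
    show "((\<lambda>x. A * std_normal_density x) \<longlongrightarrow> 0) G"
      using that by (rule tendsto_mult_right_zero)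
    show "\<forall>\<^sub>F x in G. norm (F x) \<le> A * std_normal_density x"
      unfolding F_def
      by (auto intro!: always_eventually mult_right_mono bound simp: abs_mult)
  qed
  have "(LBINT x=-\<infinity>..\<infinity>. ?f1 x - ?f2 x) = 0 - 0"
  proof (rule interval_integral_FTC_integrable[where F = F])
    show "(F has_vector_derivative ?f1 x - ?f2 x) (at x)" for x
      unfolding F_def has_real_derivative_iff_has_vector_derivative[symmetric]
      by (rule derivative_eq_intros der derd refl)+ (simp add: algebra_simps)
    show "isCont (\<lambda>x. ?f1 x - ?f2 x) x" for x
      by (intro continuous_intros contd cont\<phi> cont)
    show "set_integrable lborel (einterval (- \<infinity>) \<infinity>) (\<lambda>x. ?f1 x - ?f2 x)"
      unfolding set_integrable_def using int1 int2 by simp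
    show "((F \<circ> real_of_ereal) \<longlongrightarrow> 0) (at_right (- \<infinity>))"
      unfolding ereal_tendsto_simps1 by (rule lim[OF std_normal_density_at_bot])
    show "((F \<circ> real_of_ereal) \<longlongrightarrow> 0) (at_left \<infinity>)"
      unfolding ereal_tendsto_simps1 by (rule lim[OF std_normal_density_at_top])
  qed simp
  then have "integral\<^sup>L lborel (\<lambda>x. ?f1 x - ?f2 x) = 0"
    by (simp add: interval_lebesgue_integral_def set_lebesgue_integral_def)
  then have "integral\<^sup>L lborel ?f1 = integral\<^sup>L lborel ?f2"
    using int1 int2 by simp
  then show ?thesis
    using meas by (subst (1 2) integral_density) auto
qed

lemma integrable_gauss_component_mult:
  assumes "b \<in> I" "f \<in> borel_measurable (gauss_prod I)" "\<And>J. \<bar>f J\<bar> \<le> A"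
  shows "integrable (gauss_prod I) (\<lambda>J. J b * f J)"
proof (rule Bochner_Integration.integrable_bound)
  show "integrable (gauss_prod I) (\<lambda>J. A * \<bar>J b\<bar>)"
    by (intro integrable_mult_right integrable_abs_gauss_component assms)
  show "AE J in gauss_prod I. norm (J b * f J) \<le> norm (A * \<bar>J b\<bar>)"
  proof (rule AE_I2)
    fix J :: "'a \<Rightarrow> real"
    have "\<bar>J b\<bar> * \<bar>f J\<bar> \<le> \<bar>J b\<bar> * \<bar>A\<bar>"
      using assms(3)[of J] by (intro mult_left_mono) auto
    then show "norm (J b * f J) \<le> norm (A * \<bar>J b\<bar>)"
      by (simp add: abs_mult mult_ac)
  qed
  show "(\<lambda>J. J b * f J) \<in> borel_measurable (gauss_prod I)"
    by (intro borel_measurable_times measurable_gauss_component assms)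
qed

text \<open>Fubini isolates the coordinate \<open>b\<close>, and the one-dimensional formula is
  applied with the other couplings frozen. \<open>f'\<close> is the partial derivative in that
  coordinate.\<close>

lemma gauss_integration_by_parts:
  assumes "finite I" "b \<in> I"
    and meas: "f \<in> borel_measurable (gauss_prod I)" "f' \<in> borel_measurable (gauss_prod I)"
    and bound: "\<And>J. \<bar>f J\<bar> \<le> A" "\<And>J. \<bar>f' J\<bar> \<le> A'"
    and der: "\<And>J y. ((\<lambda>y. f (J(b := y))) has_real_derivative f' (J(b := y))) (at y)"
    and cont: "\<And>J y. isCont (\<lambda>y. f' (J(b := y))) y"
  shows "gauss_av I (\<lambda>J. J b * f J) = gauss_av I f'"
proof -
  interpret prob_space std_gauss by (rule prob_space_std_gauss)
  interpret product_sigma_finite "\<lambda>_::'a. std_gauss"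
    by unfold_locales
  define I' where "I' = I - {b}"
  have I: "I = insert b I'" "finite I'" "b \<notin> I'"
    using assms(1,2) by (auto simp: I'_def)
  have "gauss_av I (\<lambda>J. J b * f J) = (\<integral>J. (\<integral>y. y * f (J(b := y)) \<partial>std_gauss) \<partial>gauss_prod I')"
    using product_integral_insert[OF I(2,3), of "\<lambda>J. J b * f J"]
      integrable_gauss_component_mult[OF assms(2) meas(1) bound(1)]
    unfolding gauss_av_def I(1)[symmetric] by simp
  also have "\<dots> = (\<integral>J. (\<integral>y. f' (J(b := y)) \<partial>std_gauss) \<partial>gauss_prod I')"
    using std_gauss_integration_by_parts[OF der cont bound] by simp
  also have "\<dots> = gauss_av I f'"
    using product_integral_insert[OF I(2,3), of f'] integrable_gauss_bounded[OF meas(2) bound(2)]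
    unfolding gauss_av_def I(1)[symmetric] by simp
  finally show ?thesis .
qed

subsection \<open>Spin systems with Gaussian couplings\<close>

definition energy :: "'b set \<Rightarrow> ('b \<Rightarrow> 'c \<Rightarrow> real) \<Rightarrow> ('b \<Rightarrow> real) \<Rightarrow> 'c \<Rightarrow> real" where
  "energy B s x \<sigma> = (\<Sum>b\<in>B. x b * s b \<sigma>)"

definition partf :: "'c set \<Rightarrow> 'b set \<Rightarrow> ('b \<Rightarrow> 'c \<Rightarrow> real) \<Rightarrow> ('b \<Rightarrow> real) \<Rightarrow> real" where
  "partf C B s x = (\<Sum>\<sigma>\<in>C. exp (energy B s x \<sigma>))"

definition gibbs ::
    "'c set \<Rightarrow> 'b set \<Rightarrow> ('b \<Rightarrow> 'c \<Rightarrow> real) \<Rightarrow> ('b \<Rightarrow> real) \<Rightarrow> ('c \<Rightarrow> real) \<Rightarrow> real" where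
  "gibbs C B s x f = (\<Sum>\<sigma>\<in>C. f \<sigma> * exp (energy B s x \<sigma>)) / partf C B s x"

definition q_pressure :: "'c set \<Rightarrow> 'b set \<Rightarrow> ('b \<Rightarrow> 'c \<Rightarrow> real) \<Rightarrow> ('b \<Rightarrow> real) \<Rightarrow> real" where
  "q_pressure C B s w = gauss_av B (\<lambda>J. ln (partf C B s (\<lambda>b. w b * J b)))"

text \<open>The quenched two-replica overlap of the bond \<open>b\<close>: for fixed
  \<open>J\<close> the replicas are independent, so their joint mean is a square
  (\<open>replica_average\<close>). Integration by parts produces this square directly; pairs of
  configurations enter only when the quenched state is unfolded.\<close>

definition q_overlap ::
    "'c set \<Rightarrow> 'b set \<Rightarrow> ('b \<Rightarrow> 'c \<Rightarrow> real) \<Rightarrow> ('b \<Rightarrow> real) \<Rightarrow> 'b \<Rightarrow> real" where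
  "q_overlap C B s w b = gauss_av B (\<lambda>J. (gibbs C B s (\<lambda>b. w b * J b) (s b))\<^sup>2)"

text \<open>Linear in \<open>r\<close>, which stands for the square root of t; the pressure is then
  differentiable at \<open>r = 0\<close> too.\<close>

definition interp_weight :: "'b set \<Rightarrow> real \<Rightarrow> 'b \<Rightarrow> real" where
  "interp_weight D r b = (if b \<in> D then r else 1)"

text \<open>Bond spins enter only through their modulus 1, so free boxes and tori are both
  instances, including degenerate tori: with side 1 a bond joins a site to itself, with side 2 two
  bonds join the same pair.\<close>

locale spin_system =
  fixes C :: "'c set" and B :: "'b set" and s :: "'b \<Rightarrow> 'c \<Rightarrow> real"
  assumes finite_C: "finite C" and C_nonempty: "C \<noteq> {}" and finite_B: "finite B"
    and abs_spin: "\<And>b \<sigma>. b \<in> B \<Longrightarrow> \<sigma> \<in> C \<Longrightarrow> \<bar>s b \<sigma>\<bar> = 1"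
begin

lemma partf_pos: "partf C B s x > 0"
  unfolding partf_def by (intro sum_pos finite_C C_nonempty) simp

lemma abs_gibbs_le:
  assumes "\<And>\<sigma>. \<sigma> \<in> C \<Longrightarrow> \<bar>f \<sigma>\<bar> \<le> K"
  shows "\<bar>gibbs C B s x f\<bar> \<le> K"
proof -
  have "\<bar>\<Sum>\<sigma>\<in>C. f \<sigma> * exp (energy B s x \<sigma>)\<bar> \<le> (\<Sum>\<sigma>\<in>C. \<bar>f \<sigma> * exp (energy B s x \<sigma>)\<bar>)"
    by (rule sum_abs)
  also have "\<dots> \<le> (\<Sum>\<sigma>\<in>C. K * exp (energy B s x \<sigma>))"
    by (intro sum_mono) (auto simp: abs_mult intro!: mult_right_mono assms)
  also have "\<dots> = K * partf C B s x"
    by (simp add: partf_def sum_distrib_left)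
  finally show ?thesis
    using partf_pos[of x] by (simp add: gibbs_def field_simps)
qed

lemma abs_gibbs_spin_le: "b \<in> B \<Longrightarrow> \<bar>gibbs C B s x (s b)\<bar> \<le> 1"
  by (rule abs_gibbs_le) (simp add: abs_spin)

lemma gibbs_spin_square_le: "b \<in> B \<Longrightarrow> (gibbs C B s x (s b))\<^sup>2 \<le> 1"
  using abs_gibbs_spin_le[of b x] by (simp add: abs_square_le_1)

lemma gibbs_sum: "gibbs C B s x (\<lambda>\<sigma>. \<Sum>b\<in>A. y b * g b \<sigma>) = (\<Sum>b\<in>A. y b * gibbs C B s x (g b))"
  unfolding gibbs_def
  by (simp add: sum_distrib_right sum_divide_distrib[symmetric] sum_distrib_left mult.assoc
      sum.swap[of _ A C] times_divide_eq_right[symmetric] del: times_divide_eq_right)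
     (simp add: sum_divide_distrib sum_distrib_left mult_ac sum.swap[of _ A C])

lemma gibbs_energy: "gibbs C B s x (energy B s y) = (\<Sum>b\<in>B. y b * gibbs C B s x (s b))"
  using gibbs_sum[of x y s B] by (simp add: energy_def[abs_def])

lemma gibbs_energy_quotient:
  "(\<Sum>\<sigma>\<in>C. energy B s y \<sigma> * exp (energy B s x \<sigma>)) / partf C B s x
    = (\<Sum>b\<in>B. y b * gibbs C B s x (s b))"
  unfolding gibbs_energy[symmetric] by (simp only: gibbs_def)

section \<open>Derivatives with respect to the couplings\<close>

context
  fixes x :: "real \<Rightarrow> 'b \<Rightarrow> real" and x' :: "'b \<Rightarrow> real" and r :: real
  assumes x: "\<And>b. b \<in> B \<Longrightarrow> ((\<lambda>r. x r b) has_real_derivative x' b) (at r)"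
begin

text \<open>The curve \<open>x\<close> of couplings has two uses: varying the common weight
  \<open>r\<close> of a set of bonds, and varying a single Gaussian coupling.\<close>

lemma DERIV_weighted_sum:
  "((\<lambda>r. \<Sum>\<sigma>\<in>C. f \<sigma> * exp (energy B s (x r) \<sigma>)) has_real_derivative
     (\<Sum>\<sigma>\<in>C. f \<sigma> * energy B s x' \<sigma> * exp (energy B s (x r) \<sigma>))) (at r)"
  unfolding energy_def
  by (auto intro!: derivative_eq_intros x sum.cong simp: sum_distrib_left sum_distrib_right mult_ac)

lemma DERIV_partf:
  "((\<lambda>r. partf C B s (x r)) has_real_derivative
     (\<Sum>\<sigma>\<in>C. energy B s x' \<sigma> * exp (energy B s (x r) \<sigma>))) (at r)"
  using DERIV_weighted_sum[of "\<lambda>_. 1"] by (simp add: partf_def)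

lemma DERIV_ln_partf:
  "((\<lambda>r. ln (partf C B s (x r))) has_real_derivative
     (\<Sum>b\<in>B. x' b * gibbs C B s (x r) (s b))) (at r)"
  using DERIV_chain2[OF DERIV_ln[OF partf_pos] DERIV_partf]
  by (simp add: gibbs_energy_quotient[symmetric] field_simps)

text \<open>Quotient rule; the outcome is a sum of truncated correlations of \<open>f\<close> with
  the bond spins, weighted by the velocities \<open>x'\<close>.\<close>

lemma DERIV_gibbs:
  "((\<lambda>r. gibbs C B s (x r) f) has_real_derivative
     (\<Sum>b\<in>B. x' b * (gibbs C B s (x r) (\<lambda>\<sigma>. f \<sigma> * s b \<sigma>)
        - gibbs C B s (x r) f * gibbs C B s (x r) (s b)))) (at r)"
proof -
  let ?Z = "partf C B s (x r)"
  let ?A = "\<Sum>\<sigma>\<in>C. f \<sigma> * energy B s x' \<sigma> * exp (energy B s (x r) \<sigma>)"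
  let ?Z' = "\<Sum>\<sigma>\<in>C. energy B s x' \<sigma> * exp (energy B s (x r) \<sigma>)"
  let ?F = "\<Sum>\<sigma>\<in>C. f \<sigma> * exp (energy B s (x r) \<sigma>)"
  have nz: "?Z \<noteq> 0" using partf_pos[of "x r"] by simp
  have "((\<lambda>r. gibbs C B s (x r) f) has_real_derivative (?A * ?Z - ?F * ?Z') / (?Z * ?Z)) (at r)"
    unfolding gibbs_def by (rule DERIV_divide[OF DERIV_weighted_sum DERIV_partf nz])
  also have "(?A * ?Z - ?F * ?Z') / (?Z * ?Z) = ?A / ?Z - (?F / ?Z) * (?Z' / ?Z)"
    using nz by (simp add: field_simps)
  also have "?A / ?Z = gibbs C B s (x r) (\<lambda>\<sigma>. f \<sigma> * energy B s x' \<sigma>)"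
    by (simp add: gibbs_def)
  also have "(\<lambda>\<sigma>. f \<sigma> * energy B s x' \<sigma>) = (\<lambda>\<sigma>. \<Sum>b\<in>B. x' b * (f \<sigma> * s b \<sigma>))"
    by (simp add: energy_def sum_distrib_left mult_ac)
  also have "gibbs C B s (x r) \<dots> = (\<Sum>b\<in>B. x' b * gibbs C B s (x r) (\<lambda>\<sigma>. f \<sigma> * s b \<sigma>))"
    by (rule gibbs_sum)
  also have "?Z' / ?Z = (\<Sum>b\<in>B. x' b * gibbs C B s (x r) (s b))"
    by (rule gibbs_energy_quotient)
  also have "?F / ?Z = gibbs C B s (x r) f"
    by (simp add: gibbs_def)
  finally show ?thesis
    by (simp add: sum_distrib_left sum_subtractf algebra_simps)
qed

end

lemma gibbs_spin_square: "b \<in> B \<Longrightarrow> gibbs C B s x (\<lambda>\<sigma>. s b \<sigma> * s b \<sigma>) = 1"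
proof -
  assume b: "b \<in> B"
  have "s b \<sigma> * s b \<sigma> = 1" if "\<sigma> \<in> C" for \<sigma>
    using abs_spin[OF b that] by (metis abs_mult_self_eq mult_1)
  then show ?thesis
    using partf_pos[of x] by (simp add: gibbs_def partf_def)
qed

section \<open>Measurability and integrability in the couplings\<close>

lemma measurable_energy:
  "(\<lambda>J. energy B s (\<lambda>b. w b * J b) \<sigma>) \<in> borel_measurable (gauss_prod B)"
  unfolding energy_def
  by (intro borel_measurable_sum borel_measurable_times borel_measurable_const
      measurable_gauss_component)

lemma measurable_partf:
  "(\<lambda>J. partf C B s (\<lambda>b. w b * J b)) \<in> borel_measurable (gauss_prod B)"
  unfolding partf_def
  by (intro borel_measurable_sum measurable_compose[OF measurable_energy borel_measurable_exp])

lemma measurable_ln_partf: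
  "(\<lambda>J. ln (partf C B s (\<lambda>b. w b * J b))) \<in> borel_measurable (gauss_prod B)"
  by (rule borel_measurable_ln[OF measurable_partf])

lemma measurable_gibbs:
  "(\<lambda>J. gibbs C B s (\<lambda>b. w b * J b) f) \<in> borel_measurable (gauss_prod B)"
  unfolding gibbs_def
  by (intro borel_measurable_divide measurable_partf borel_measurable_sum borel_measurable_times
      borel_measurable_const measurable_compose[OF measurable_energy borel_measurable_exp])

lemma measurable_gibbs_square:
  "(\<lambda>J. (gibbs C B s (\<lambda>b. w b * J b) f)\<^sup>2) \<in> borel_measurable (gauss_prod B)"
  by (intro borel_measurable_power measurable_gibbs)

lemma integrable_gibbs_square:
  "b \<in> B \<Longrightarrow> integrable (gauss_prod B) (\<lambda>J. (gibbs C B s (\<lambda>b. w b * J b) (s b))\<^sup>2)"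
  by (rule integrable_gauss_bounded[where K = 1, OF measurable_gibbs_square])
     (simp add: gibbs_spin_square_le)

lemma q_overlap_nonneg: "q_overlap C B s w b \<ge> 0"
  unfolding q_overlap_def gauss_av_def by (rule Bochner_Integration.integral_nonneg) simp

lemma q_overlap_le_1: "b \<in> B \<Longrightarrow> q_overlap C B s w b \<le> 1"
proof -
  assume b: "b \<in> B"
  interpret P: prob_space "gauss_prod B" by (rule prob_space_gauss_prod)
  have "q_overlap C B s w b \<le> integral\<^sup>L (gauss_prod B) (\<lambda>_. 1)"
    unfolding q_overlap_def gauss_av_def
    by (intro integral_mono integrable_gibbs_square b) (auto simp: gibbs_spin_square_le b)
  then show ?thesis by (simp add: P.prob_space)
qed

text \<open>With A the sum of the moduli of the couplings, every Boltzmann factor lies between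
  exp(-A) and exp(A). The bound is linear in the couplings, hence integrable for Gaussians.\<close>

lemma abs_ln_partf_le: "\<bar>ln (partf C B s x)\<bar> \<le> ln (card C) + (\<Sum>b\<in>B. \<bar>x b\<bar>)"
proof -
  let ?A = "\<Sum>b\<in>B. \<bar>x b\<bar>"
  have card: "real (card C) \<ge> 1"
    using finite_C C_nonempty by (simp add: Suc_le_eq card_gt_0_iff)
  have E: "\<bar>energy B s x \<sigma>\<bar> \<le> ?A" if "\<sigma> \<in> C" for \<sigma>
  proof -
    have "\<bar>energy B s x \<sigma>\<bar> \<le> (\<Sum>b\<in>B. \<bar>x b * s b \<sigma>\<bar>)"
      unfolding energy_def by (rule sum_abs)
    then show ?thesis using that by (simp add: abs_mult abs_spin)
  qed
  have "partf C B s x \<le> (\<Sum>\<sigma>\<in>C. exp ?A)"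
    unfolding partf_def using E by (intro sum_mono) (simp add: abs_le_iff)
  then have "ln (partf C B s x) \<le> ln (card C * exp ?A)"
    using card by (subst ln_le_cancel_iff) (auto simp: partf_pos)
  then have 1: "ln (partf C B s x) \<le> ln (card C) + ?A"
    using card by (simp add: ln_mult)
  have "(\<Sum>\<sigma>\<in>C. exp (- ?A)) \<le> partf C B s x"
    unfolding partf_def using E by (intro sum_mono) (simp add: abs_le_iff, smt (verit))
  then have "ln (card C * exp (- ?A)) \<le> ln (partf C B s x)"
    using card by (subst ln_le_cancel_iff) (auto simp: partf_pos)
  then have 2: "ln (card C) - ?A \<le> ln (partf C B s x)"
    using card by (simp add: ln_mult)
  show ?thesis
    using 1 2 card ln_ge_zero[OF card] by linarith
qed

lemma integrable_ln_partf:
  "integrable (gauss_prod B) (\<lambda>J. ln (partf C B s (\<lambda>b. w b * J b)))"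
proof (rule Bochner_Integration.integrable_bound)
  interpret P: prob_space "gauss_prod B" by (rule prob_space_gauss_prod)
  show "integrable (gauss_prod B) (\<lambda>J. ln (card C) + (\<Sum>b\<in>B. \<bar>w b\<bar> * \<bar>J b\<bar>))"
    by (intro Bochner_Integration.integrable_add Bochner_Integration.integrable_sum
        integrable_mult_right integrable_abs_gauss_component P.integrable_const)
  show "AE J in gauss_prod B. norm (ln (partf C B s (\<lambda>b. w b * J b)))
      \<le> norm (ln (card C) + (\<Sum>b\<in>B. \<bar>w b\<bar> * \<bar>J b\<bar>))"
  proof (rule AE_I2)
    fix J
    show "norm (ln (partf C B s (\<lambda>b. w b * J b))) \<le> norm (ln (card C) + (\<Sum>b\<in>B. \<bar>w b\<bar> * \<bar>J b\<bar>))"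
      using abs_ln_partf_le[of "\<lambda>b. w b * J b"] by (simp add: abs_mult)
  qed
qed (rule measurable_ln_partf)

text \<open>Integration by parts for the Gibbs mean of \<open>s b\<close>: its derivative in
  \<open>J b\<close> is \<open>w b\<close> times the truncated self-correlation, which is 1 minus
  the squared mean because \<open>s b\<close> squares to 1.\<close>

lemma gauss_av_component_gibbs:
  assumes b: "b \<in> B"
  shows "gauss_av B (\<lambda>J. J b * gibbs C B s (\<lambda>b. w b * J b) (s b)) = w b * (1 - q_overlap C B s w b)"
proof -
  interpret P: prob_space "gauss_prod B" by (rule prob_space_gauss_prod)
  let ?f = "\<lambda>J. gibbs C B s (\<lambda>b. w b * J b) (s b)"
  let ?f' = "\<lambda>J. w b * (1 - (gibbs C B s (\<lambda>b. w b * J b) (s b))\<^sup>2)"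
  have D: "((\<lambda>y. ?f (J(b := y))) has_real_derivative ?f' (J(b := y))) (at y)" for J y
  proof -
    have *: "((\<lambda>y. w c * (J(b := y)) c) has_real_derivative (if c = b then w b else 0)) (at y)" for c
      by (auto intro!: derivative_eq_intros)
    \<comment> \<open>Only the coupling of \<open>b\<close> moves, so correlations with all other
      bonds drop out.\<close>
    have "(\<Sum>c\<in>B. (if c = b then w b else 0) * (gibbs C B s (\<lambda>c. w c * (J(b := y)) c) (\<lambda>\<sigma>. s b \<sigma> * s c \<sigma>)
        - ?f (J(b := y)) * gibbs C B s (\<lambda>c. w c * (J(b := y)) c) (s c)))
      = (\<Sum>c\<in>B. if c = b then ?f' (J(b := y)) else 0)"
      using gibbs_spin_square[OF b] by (intro sum.cong) (auto simp: power2_eq_square)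
    also have "\<dots> = ?f' (J(b := y))"
      using b finite_B by simp
    finally show ?thesis
      using DERIV_gibbs[of "\<lambda>y c. w c * (J(b := y)) c" "\<lambda>c. if c = b then w b else 0" y "s b", OF *]
      by simp
  qed
  have "gauss_av B (\<lambda>J. J b * ?f J) = gauss_av B ?f'"
  proof (rule gauss_integration_by_parts[OF finite_B b, where A = 1 and A' = "\<bar>w b\<bar>"])
    show "?f' \<in> borel_measurable (gauss_prod B)"
      by (intro borel_measurable_times borel_measurable_diff borel_measurable_const
          measurable_gibbs_square)
    show "\<bar>?f' J\<bar> \<le> \<bar>w b\<bar>" for J
    proof -
      have "\<bar>1 - (?f J)\<^sup>2\<bar> \<le> 1"
        using gibbs_spin_square_le[OF b, of "\<lambda>b. w b * J b"]
        by (smt (verit) zero_le_power2)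
      then show ?thesis by (simp add: abs_mult mult_left_le)
    qed
    show "isCont (\<lambda>y. ?f' (J(b := y))) y" for J y
      by (intro continuous_intros DERIV_isCont[OF D])
  qed (use D measurable_gibbs abs_gibbs_spin_le[OF b] in auto)
  also have "\<dots> = w b * (1 - q_overlap C B s w b)"
    unfolding gauss_av_def q_overlap_def
    by (simp add: Bochner_Integration.integral_diff integrable_gibbs_square b P.prob_space)
  finally show ?thesis .
qed

text \<open>The derivative of the logarithm is the sum over \<open>D\<close> of \<open>J b\<close>
  times a Gibbs mean, dominated for every \<open>r\<close> by the sum of the moduli of the
  couplings. Integration by parts then brings out the weight of the bond, which is \<open>r\<close>
  on \<open>D\<close>.\<close>

lemma DERIV_q_pressure:
  assumes D: "D \<subseteq> B"
  shows "((\<lambda>r. q_pressure C B s (interp_weight D r)) has_real_derivative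
     r * (\<Sum>b\<in>D. 1 - q_overlap C B s (interp_weight D r) b)) (at r)"
proof -
  let ?f' = "\<lambda>r J. \<Sum>b\<in>B. (if b \<in> D then J b else 0) * gibbs C B s (\<lambda>b. interp_weight D r b * J b) (s b)"
  have "((\<lambda>r. q_pressure C B s (interp_weight D r)) has_real_derivative
      integral\<^sup>L (gauss_prod B) (?f' r)) (at r)"
    unfolding q_pressure_def gauss_av_def
  proof (rule has_real_derivative_integral[where g = "\<lambda>J. \<Sum>b\<in>B. \<bar>J b\<bar>"])
    show "((\<lambda>r. ln (partf C B s (\<lambda>b. interp_weight D r b * J b))) has_real_derivative ?f' r J) (at r)"
      for r J
      unfolding interp_weight_def
      by (rule DERIV_ln_partf) (auto intro!: derivative_eq_intros)
    show "?f' r \<in> borel_measurable (gauss_prod B)"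
      by (auto intro!: borel_measurable_sum borel_measurable_times measurable_gibbs
          measurable_gauss_component)
    show "\<bar>?f' r J\<bar> \<le> (\<Sum>b\<in>B. \<bar>J b\<bar>)" for r J
      by (rule order_trans[OF sum_abs], intro sum_mono)
         (auto simp: abs_mult intro!: mult_left_le abs_gibbs_spin_le)
    show "integrable (gauss_prod B) (\<lambda>J. \<Sum>b\<in>B. \<bar>J b\<bar>)"
      by (intro Bochner_Integration.integrable_sum integrable_abs_gauss_component)
  qed (rule integrable_ln_partf)
  also have "?f' r = (\<lambda>J. \<Sum>b\<in>D. J b * gibbs C B s (\<lambda>b. interp_weight D r b * J b) (s b))"
    using D finite_B by (auto simp: fun_eq_iff intro!: sum.mono_neutral_cong_right)
  also have "integral\<^sup>L (gauss_prod B) \<dots> =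
      (\<Sum>b\<in>D. gauss_av B (\<lambda>J. J b * gibbs C B s (\<lambda>b. interp_weight D r b * J b) (s b)))"
    unfolding gauss_av_def
    using D by (intro Bochner_Integration.integral_sum integrable_gauss_component_mult[where A = 1]
        measurable_gibbs) (auto intro: abs_gibbs_spin_le)
  also have "\<dots> = (\<Sum>b\<in>D. r * (1 - q_overlap C B s (interp_weight D r) b))"
  proof (rule sum.cong)
    fix b assume "b \<in> D"
    then show "gauss_av B (\<lambda>J. J b * gibbs C B s (\<lambda>b. interp_weight D r b * J b) (s b))
        = r * (1 - q_overlap C B s (interp_weight D r) b)"
      using gauss_av_component_gibbs[of b "interp_weight D r"] D
      by (auto simp: interp_weight_def[of D r b])
  qed simp
  finally show ?thesis by (simp add: sum_distrib_left)
qed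

text \<open>The substitution $r = \sqrt t$ turns the factor $r$ into the constant $1/2$.\<close>

lemma q_pressure_interpolation:
  assumes "D \<subseteq> B"
  shows "((\<lambda>t. (\<Sum>b\<in>D. 1 - q_overlap C B s (interp_weight D (sqrt t)) b) / 2) has_integral
     q_pressure C B s (interp_weight D 1) - q_pressure C B s (interp_weight D 0)) {0..1}"
proof -
  let ?G = "\<lambda>r. q_pressure C B s (interp_weight D r)"
  let ?S = "\<lambda>t. \<Sum>b\<in>D. 1 - q_overlap C B s (interp_weight D (sqrt t)) b"
  \<comment> \<open>\<open>sqrt\<close> has no derivative at 0, so differentiability is used in the
    open interval only, with continuity at the ends.\<close>
  have "((\<lambda>t. ?S t / 2) has_integral ?G (sqrt 1) - ?G (sqrt 0)) {0..1}"
  proof (rule fundamental_theorem_of_calculus_interior)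
    have "continuous_on UNIV ?G"
      by (intro continuous_at_imp_continuous_on ballI DERIV_isCont[OF DERIV_q_pressure] assms)
    then show "continuous_on {0..1} (\<lambda>t. ?G (sqrt t))"
      by (rule continuous_on_compose2) (auto intro!: continuous_intros)
    fix t :: real assume t: "t \<in> {0<..<1}"
    have "((\<lambda>t. ?G (sqrt t)) has_real_derivative (sqrt t * ?S t) * (inverse (sqrt t) / 2)) (at t)"
      using t by (intro DERIV_chain2[OF DERIV_q_pressure[OF assms] DERIV_real_sqrt]) auto
    also have "(sqrt t * ?S t) * (inverse (sqrt t) / 2) = ?S t / 2"
      using t by (simp add: field_simps)
    finally show "((\<lambda>t. ?G (sqrt t)) has_vector_derivative ?S t / 2) (at t)"
      by (simp add: has_real_derivative_iff_has_vector_derivative)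
  qed simp
  then show ?thesis by simp
qed

text \<open>Overlaps lie in [0, 1], so the integrand of the interpolation formula lies between 0 and
  half the number of cut bonds. These two bounds yield both the existence of the pressure and the
  final bounds -1/4 and 0.\<close>

lemma q_pressure_cut_bounds:
  assumes "D \<subseteq> B"
  shows "q_pressure C B s (interp_weight D 0) \<le> q_pressure C B s (interp_weight D 1)"
    and "q_pressure C B s (interp_weight D 1) \<le> q_pressure C B s (interp_weight D 0) + card D / 2"
proof -
  let ?S = "\<lambda>t. \<Sum>b\<in>D. 1 - q_overlap C B s (interp_weight D (sqrt t)) b"
  have S: "0 \<le> ?S t" "?S t \<le> card D" for t
    using assms q_overlap_nonneg sum_bounded_above[of D "\<lambda>b. 1 - q_overlap C B s (interp_weight D (sqrt t)) b" 1]
    by (auto intro!: sum_nonneg q_overlap_le_1)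
  note I = q_pressure_interpolation[OF assms]
  show "q_pressure C B s (interp_weight D 0) \<le> q_pressure C B s (interp_weight D 1)"
    using has_integral_nonneg[OF I] S(1) by simp
  have "((\<lambda>t. card D / 2) has_integral card D / 2) {0..1::real}"
    using has_integral_const_real[of "card D / 2" 0 1] by simp
  from has_integral_le[OF I this] S(2)
  show "q_pressure C B s (interp_weight D 1) \<le> q_pressure C B s (interp_weight D 0) + card D / 2"
    by simp
qed

end

subsection \<open>Embeddings and independent subsystems\<close>

lemma energy_cong: "(\<And>b. b \<in> B \<Longrightarrow> x b = y b) \<Longrightarrow> energy B s x = energy B s y"
  by (simp add: energy_def fun_eq_iff)

lemma partf_cong: "(\<And>b. b \<in> B \<Longrightarrow> x b = y b) \<Longrightarrow> partf C B s x = partf C B s y"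
  by (simp add: partf_def cong: energy_cong)

lemma gibbs_cong: "(\<And>b. b \<in> B \<Longrightarrow> x b = y b) \<Longrightarrow> gibbs C B s x f = gibbs C B s y f"
  by (simp add: gibbs_def partf_def cong: energy_cong)

lemma energy_embed:
  assumes "inj_on g B" "\<sigma> \<in> C" "\<And>b \<sigma>. b \<in> B \<Longrightarrow> \<sigma> \<in> C \<Longrightarrow> s' (g b) (F \<sigma>) = s b \<sigma>"
  shows "energy (g ` B) s' x (F \<sigma>) = energy B s (\<lambda>b. x (g b)) \<sigma>"
  using assms by (simp add: energy_def sum.reindex)

lemma partf_embed:
  assumes "inj_on g B" "bij_betw F C C'"
    and "\<And>b \<sigma>. b \<in> B \<Longrightarrow> \<sigma> \<in> C \<Longrightarrow> s' (g b) (F \<sigma>) = s b \<sigma>"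
  shows "partf C' (g ` B) s' x = partf C B s (\<lambda>b. x (g b))"
  unfolding partf_def sum.reindex_bij_betw[OF assms(2), symmetric]
  using assms energy_embed[of g B _ C s' F s x] by (intro sum.cong) auto

lemma gibbs_embed:
  assumes "inj_on g B" "bij_betw F C C'"
    and "\<And>b \<sigma>. b \<in> B \<Longrightarrow> \<sigma> \<in> C \<Longrightarrow> s' (g b) (F \<sigma>) = s b \<sigma>"
  shows "gibbs C' (g ` B) s' x f = gibbs C B s (\<lambda>b. x (g b)) (\<lambda>\<sigma>. f (F \<sigma>))"
proof -
  have "(\<Sum>\<sigma>\<in>C'. f \<sigma> * exp (energy (g ` B) s' x \<sigma>))
      = (\<Sum>\<sigma>\<in>C. f (F \<sigma>) * exp (energy B s (\<lambda>b. x (g b)) \<sigma>))"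
    unfolding sum.reindex_bij_betw[OF assms(2), symmetric]
    using assms energy_embed[of g B _ C s' F s x] by (intro sum.cong) auto
  then show ?thesis
    using partf_embed[of g B F C C' s' s x] assms by (simp add: gibbs_def)
qed

context spin_system
begin

lemma partf_weight_embed:
  assumes g: "inj_on g B" and F: "bij_betw F C C'"
    and s': "\<And>b \<sigma>. b \<in> B \<Longrightarrow> \<sigma> \<in> C \<Longrightarrow> s' (g b) (F \<sigma>) = s b \<sigma>"
    and w: "\<And>b. b \<in> B \<Longrightarrow> w' (g b) = w b"
  shows "partf C' (g ` B) s' (\<lambda>b. w' b * J b) = partf C B s (\<lambda>b. w b * (\<lambda>n\<in>B. J (g n)) b)"
proof -
  have "partf C' (g ` B) s' (\<lambda>b. w' b * J b) = partf C B s (\<lambda>b. w' (g b) * J (g b))"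
    using g F s' by (intro partf_embed) auto
  also have "\<dots> = partf C B s (\<lambda>b. w b * (\<lambda>n\<in>B. J (g n)) b)"
    by (rule partf_cong) (simp add: w)
  finally show ?thesis .
qed

text \<open>\<open>K\<close> may contain couplings outside the image of \<open>g\<close>; they
  integrate out. This allows a single block to be averaged over all couplings of the torus.\<close>

lemma q_pressure_embed:
  assumes g: "inj_on g B" "g \<in> B \<rightarrow> K" and F: "bij_betw F C C'"
    and s': "\<And>b \<sigma>. b \<in> B \<Longrightarrow> \<sigma> \<in> C \<Longrightarrow> s' (g b) (F \<sigma>) = s b \<sigma>"
    and w: "\<And>b. b \<in> B \<Longrightarrow> w' (g b) = w b"
  shows "integrable (gauss_prod K) (\<lambda>J. ln (partf C' (g ` B) s' (\<lambda>b. w' b * J b)))"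
    and "gauss_av K (\<lambda>J. ln (partf C' (g ` B) s' (\<lambda>b. w' b * J b))) = q_pressure C B s w"
  using partf_weight_embed[of g F C' s' w' w] g(1) F s' w
    integrable_gauss_reindex[OF g integrable_ln_partf[of w]]
    gauss_av_reindex[OF g measurable_ln_partf[of w]]
  by (simp_all add: q_pressure_def)

text \<open>Isomorphic systems have equal overlaps because the couplings are i.i.d. It is used for
  an automorphism of the torus, where both systems coincide.\<close>

lemma q_overlap_iso:
  assumes g: "inj_on g B" and F: "bij_betw F C C'"
    and s': "\<And>b \<sigma>. b \<in> B \<Longrightarrow> \<sigma> \<in> C \<Longrightarrow> s' (g b) (F \<sigma>) = s b \<sigma>"
    and w: "\<And>b. b \<in> B \<Longrightarrow> w' (g b) = w b" and a: "a \<in> B"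
  shows "q_overlap C' (g ` B) s' w' (g a) = q_overlap C B s w a"
proof -
  have "gibbs C' (g ` B) s' (\<lambda>b. w' b * J b) (s' (g a))
      = gibbs C B s (\<lambda>b. w b * (\<lambda>n\<in>B. J (g n)) b) (s a)" for J
  proof -
    have "gibbs C' (g ` B) s' (\<lambda>b. w' b * J b) (s' (g a))
      = gibbs C B s (\<lambda>b. w' (g b) * J (g b)) (\<lambda>\<sigma>. s' (g a) (F \<sigma>))"
      using g F s' by (intro gibbs_embed) auto
    also have "\<dots> = gibbs C B s (\<lambda>b. w' (g b) * J (g b)) (s a)"
      using s'[OF a] by (simp add: gibbs_def)
    also have "\<dots> = gibbs C B s (\<lambda>b. w b * (\<lambda>n\<in>B. J (g n)) b) (s a)"
      by (rule gibbs_cong) (simp add: w)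
    finally show ?thesis .
  qed
  then show ?thesis
    using gauss_av_reindex[OF g _ measurable_gibbs_square[of w "s a"], of "g ` B"]
    by (simp add: q_overlap_def)
qed

end

section \<open>Configurations and factorization over disjoint regions\<close>

lemma bij_betw_configs:
  assumes "bij_betw \<phi> S S'"
  shows "bij_betw (\<lambda>\<sigma>. \<lambda>n\<in>S'. \<sigma> (inv_into S \<phi> n)) (configs S) (configs S')"
proof (rule bij_betwI[where g = "\<lambda>\<tau>. \<lambda>n\<in>S. \<tau> (\<phi> n)"])
  have 1: "inv_into S \<phi> n \<in> S" "\<phi> (inv_into S \<phi> n) = n" if "n \<in> S'" for n
    using that assms by (auto simp: bij_betw_def inv_into_into f_inv_into_f)
  have 2: "\<phi> n \<in> S'" "inv_into S \<phi> (\<phi> n) = n" if "n \<in> S" for n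
    using that assms by (auto simp: bij_betw_def)
  show "(\<lambda>\<sigma>. \<lambda>n\<in>S'. \<sigma> (inv_into S \<phi> n)) \<in> configs S \<rightarrow> configs S'"
    using 1 by (auto simp: configs_def PiE_def)
  show "(\<lambda>\<tau>. \<lambda>n\<in>S. \<tau> (\<phi> n)) \<in> configs S' \<rightarrow> configs S"
    using 2 by (auto simp: configs_def PiE_def)
  show "(\<lambda>n\<in>S. (\<lambda>n\<in>S'. x (inv_into S \<phi> n)) (\<phi> n)) = x" if "x \<in> configs S" for x
    using that 2 by (auto simp: configs_def PiE_def extensional_def restrict_def intro!: ext)
  show "(\<lambda>n\<in>S'. (\<lambda>n\<in>S. y (\<phi> n)) (inv_into S \<phi> n)) = y" if "y \<in> configs S'" for y
    using that 1 by (auto simp: configs_def PiE_def extensional_def restrict_def intro!: ext)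
qed

lemma finite_configs: "finite S \<Longrightarrow> finite (configs S)"
  by (simp add: configs_def finite_PiE)

lemma configs_nonempty: "configs S \<noteq> {}"
  by (simp add: configs_def PiE_eq_empty_iff)

lemma abs_config: "\<sigma> \<in> configs S \<Longrightarrow> n \<in> S \<Longrightarrow> \<bar>\<sigma> n\<bar> = 1"
  by (auto simp: configs_def PiE_def Pi_def)

definition local_spin :: "site set \<Rightarrow> ((site \<Rightarrow> real) \<Rightarrow> real) \<Rightarrow> bool" where
  "local_spin S f \<longleftrightarrow> (\<forall>\<sigma> \<tau>. (\<forall>n\<in>S. \<sigma> n = \<tau> n) \<longrightarrow> f \<sigma> = f \<tau>)"

lemma local_spin_mono: "local_spin S f \<Longrightarrow> S \<subseteq> T \<Longrightarrow> local_spin T f"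
  unfolding local_spin_def by blast

lemma energy_restrict:
  assumes "\<And>b. b \<in> B \<Longrightarrow> local_spin S (s b)"
  shows "energy B s x (restrict \<sigma> S) = energy B s x \<sigma>"
  using assms unfolding energy_def local_spin_def
  by (intro sum.cong refl arg_cong2[where f = "(*)"]) (metis restrict_apply')

text \<open>A configuration on the union is a pair of restrictions, glued back by
  \<open>merge\<close>. By locality each part of the energy sees one restriction only, so the sum
  over pairs factorizes.\<close>

lemma partf_disjoint_Un:
  assumes "S \<inter> T = {}" "A \<inter> B = {}" "finite A" "finite B"
    and A: "\<And>b. b \<in> A \<Longrightarrow> local_spin S (s b)" and B: "\<And>b. b \<in> B \<Longrightarrow> local_spin T (s b)"
  shows "partf (configs (S \<union> T)) (A \<union> B) s x = partf (configs S) A s x * partf (configs T) B s x"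
proof -
  have "partf (configs (S \<union> T)) (A \<union> B) s x
      = (\<Sum>\<rho>\<in>configs (S \<union> T). exp (energy A s x \<rho>) * exp (energy B s x \<rho>))"
    using assms by (simp add: partf_def energy_def sum.union_disjoint exp_add)
  also have "\<dots> = (\<Sum>(\<sigma>, \<tau>)\<in>configs S \<times> configs T. exp (energy A s x \<sigma>) * exp (energy B s x \<tau>))"
  proof (rule sum.reindex_bij_witness[where i = "merge S T" and j = "\<lambda>\<rho>. (restrict \<rho> S, restrict \<rho> T)"])
    show "merge S T (restrict \<rho> S, restrict \<rho> T) = \<rho>" if "\<rho> \<in> configs (S \<union> T)" for \<rho>
      using that by (auto simp: configs_def merge_def fun_eq_iff PiE_def extensional_def)
    show "(restrict (merge S T p) S, restrict (merge S T p) T) = p" if "p \<in> configs S \<times> configs T" for p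
      using that assms(1)
      by (cases p) (auto simp: configs_def merge_def fun_eq_iff PiE_def extensional_def)
    show "merge S T p \<in> configs (S \<union> T)" if "p \<in> configs S \<times> configs T" for p
      using that by (cases p) (auto simp: configs_def merge_def PiE_def Pi_def extensional_def)
    show "(restrict \<rho> S, restrict \<rho> T) \<in> configs S \<times> configs T" if "\<rho> \<in> configs (S \<union> T)" for \<rho>
      using that by (auto simp: configs_def PiE_def)
    show "(case (restrict \<rho> S, restrict \<rho> T) of (\<sigma>, \<tau>) \<Rightarrow> exp (energy A s x \<sigma>) * exp (energy B s x \<tau>))
        = exp (energy A s x \<rho>) * exp (energy B s x \<rho>)" for \<rho>
      using energy_restrict[of A S s x \<rho>] energy_restrict[of B T s x \<rho>] A B by simp
  qed
  also have "\<dots> = partf (configs S) A s x * partf (configs T) B s x"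
    by (simp add: partf_def sum_product sum.cartesian_product)
  finally show ?thesis .
qed

lemma partf_disjoint_UN:
  assumes "finite X" "\<And>i. i \<in> X \<Longrightarrow> finite (E i)"
    and "disjoint_family_on S X" "disjoint_family_on E X"
    and "\<And>i b. i \<in> X \<Longrightarrow> b \<in> E i \<Longrightarrow> local_spin (S i) (s b)"
  shows "partf (configs (\<Union>i\<in>X. S i)) (\<Union>i\<in>X. E i) s x = (\<Prod>i\<in>X. partf (configs (S i)) (E i) s x)"
  using assms
proof (induction X rule: finite_induct)
  case empty
  then show ?case by (simp add: partf_def configs_def energy_def)
next
  case (insert i X)
  have "S i \<inter> (\<Union>j\<in>X. S j) = {}" "E i \<inter> (\<Union>j\<in>X. E j) = {}"
    using insert.hyps(2) insert.prems(2,3) by (fastforce simp: disjoint_family_on_def)+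
  moreover have "local_spin (\<Union>j\<in>X. S j) (s b)" if "b \<in> (\<Union>j\<in>X. E j)" for b
    using that insert.prems(4) by (auto intro: local_spin_mono)
  ultimately have "partf (configs (S i \<union> (\<Union>j\<in>X. S j))) (E i \<union> (\<Union>j\<in>X. E j)) s x
      = partf (configs (S i)) (E i) s x * partf (configs (\<Union>j\<in>X. S j)) (\<Union>j\<in>X. E j) s x"
    using insert by (intro partf_disjoint_Un) auto
  also have "partf (configs (\<Union>j\<in>X. S j)) (\<Union>j\<in>X. E j) s x = (\<Prod>i\<in>X. partf (configs (S i)) (E i) s x)"
    using insert by (intro insert.IH) (auto simp: disjoint_family_on_def)
  finally show ?case
    using insert.hyps by simp
qed

lemma partf_zero_weight:
  assumes "finite B" "A \<subseteq> B" "\<And>b. b \<in> B - A \<Longrightarrow> x b = 0"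
  shows "partf C B s x = partf C A s x"
proof -
  have "(\<Sum>b\<in>B. x b * s b \<sigma>) = (\<Sum>b\<in>A. x b * s b \<sigma>)" for \<sigma>
    using assms by (intro sum.mono_neutral_right) auto
  then show ?thesis by (simp add: partf_def energy_def)
qed

subsection \<open>Boxes and tori\<close>

text \<open>\<open>h\<close> supplies the second endpoint; the bond spins of box and torus differ
  only in this choice.\<close>

definition bond_spin :: "(bond \<Rightarrow> site) \<Rightarrow> bond \<Rightarrow> (site \<Rightarrow> real) \<Rightarrow> real" where
  "bond_spin h b \<sigma> = \<sigma> (fst b) * \<sigma> (h b)"

abbreviation free_spin :: "bond \<Rightarrow> (site \<Rightarrow> real) \<Rightarrow> real" where
  "free_spin \<equiv> bond_spin (\<lambda>b. shift (fst b) (snd b))"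

abbreviation torus_spin :: "(nat \<Rightarrow> nat) \<Rightarrow> bond \<Rightarrow> (site \<Rightarrow> real) \<Rightarrow> real" where
  "torus_spin M \<equiv> bond_spin (\<lambda>b. tshift M (fst b) (snd b))"

lemma lat_box_dflt: "lat_box d L = PiE_dflt {..<d} 0 (\<lambda>i. {1..L i})"
  by (auto simp: lat_box_def PiE_dflt_def not_less)

lemma finite_lat_box: "finite (lat_box d L)"
  unfolding lat_box_dflt by (rule finite_PiE_dflt) auto

lemma card_lat_box: "card (lat_box d L) = (\<Prod>i<d. L i)"
  unfolding lat_box_dflt by (subst card_PiE_dflt) auto

lemma torus_bonds_eq: "torus_bonds d M = lat_box d M \<times> {..<d}"
  by (auto simp: torus_bonds_def)

lemma finite_torus_bonds: "finite (torus_bonds d M)"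
  by (simp add: torus_bonds_eq finite_lat_box)

lemma bdry_bonds_subset: "bdry_bonds d L \<subseteq> torus_bonds d L"
  and free_bonds_subset: "free_bonds d L \<subseteq> torus_bonds d L"
  by (auto simp: torus_bonds_def bdry_bonds_def free_bonds_def)

lemma finite_bdry_bonds: "finite (bdry_bonds d L)"
  and finite_free_bonds: "finite (free_bonds d L)"
  using finite_subset[OF bdry_bonds_subset finite_torus_bonds]
    finite_subset[OF free_bonds_subset finite_torus_bonds] by auto

text \<open>Counted by direction: for fixed \<open>i\<close> the starting sites form the face where
  coordinate \<open>i\<close> is \<open>L i\<close> and the other coordinates are free. The swap
  puts the direction first, so that the set becomes a dependent sum.\<close>

lemma card_bdry_bonds:
  assumes "\<forall>i<d. L i \<ge> 1"
  shows "card (bdry_bonds d L) = (\<Sum>i<d. \<Prod>j\<in>{..<d} - {i}. L j)"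
proof -
  let ?P = "\<lambda>i. PiE_dflt {..<d} 0 (\<lambda>j. if j = i then {L i} else {1..L j})"
  have "bdry_bonds d L = prod.swap ` (SIGMA i:{..<d}. ?P i)"
  proof (intro set_eqI iffI)
    fix b assume "b \<in> bdry_bonds d L"
    then show "b \<in> prod.swap ` (SIGMA i:{..<d}. ?P i)"
      using assms
      by (intro image_eqI[where x = "prod.swap b"])
         (auto simp: bdry_bonds_def lat_box_def PiE_dflt_def not_less)
  next
    fix b assume "b \<in> prod.swap ` (SIGMA i:{..<d}. ?P i)"
    then show "b \<in> bdry_bonds d L"
      using assms by (force simp: bdry_bonds_def lat_box_def PiE_dflt_def split: if_splits)
  qed
  then have "card (bdry_bonds d L) = card (SIGMA i:{..<d}. ?P i)"
    by (simp add: card_image)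
  also have "\<dots> = (\<Sum>i<d. card (?P i))"
    by (intro card_SigmaI ballI finite_PiE_dflt) auto
  also have "\<dots> = (\<Sum>i<d. \<Prod>j\<in>{..<d} - {i}. L j)"
  proof (intro sum.cong refl)
    fix i assume i: "i \<in> {..<d}"
    have "card (?P i) = (\<Prod>j<d. if j = i then 1 else L j)"
      by (subst card_PiE_dflt) (auto intro!: prod.cong)
    then show "card (?P i) = (\<Prod>j\<in>{..<d} - {i}. L j)"
      using i by (simp add: prod.remove[of _ i])
  qed
  finally show ?thesis .
qed

lemma card_bdry_bonds_pos:
  assumes "d \<ge> 1" "\<forall>i<d. L i \<ge> 1"
  shows "card (bdry_bonds d L) > 0"
proof -
  \<comment> \<open>The corner with the largest coordinates, in direction 0; such a direction exists
    because \<open>d \<ge> 1\<close>.\<close>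
  have "(\<lambda>i. if i < d then L i else 0, 0) \<in> bdry_bonds d L"
    using assms by (auto simp: bdry_bonds_def lat_box_def)
  then show ?thesis using finite_bdry_bonds[of d L] by (auto simp: card_gt_0_iff)
qed

text \<open>The two opposite faces of a direction are joined by one layer of torus bonds, hence the
  factor 2.\<close>

lemma surface_eq_card_bdry_bonds:
  "\<forall>i<d. L i \<ge> 1 \<Longrightarrow> surface d L = 2 * card (bdry_bonds d L)"
  by (simp add: surface_def card_bdry_bonds)

text \<open>In this form the surface-to-volume ratio visibly vanishes as all sides grow, which makes
  the cost of cutting negligible per site.\<close>

lemma card_bdry_bonds_quotient:
  assumes "\<forall>i<d. L i \<ge> 1"
  shows "real (card (bdry_bonds d L)) / real (card (lat_box d L)) = (\<Sum>i<d. 1 / real (L i))"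
proof -
  have "real (\<Prod>j\<in>{..<d} - {i}. L j) / real (\<Prod>j<d. L j) = 1 / real (L i)" if "i < d" for i
  proof -
    have "real (\<Prod>j<d. L j) = real (L i) * real (\<Prod>j\<in>{..<d} - {i}. L j)"
      using that by (simp add: prod.remove[of "{..<d}" i])
    moreover have "(\<Prod>j\<in>{..<d} - {i}. L j) > 0"
      using assms by (intro prod_pos) auto
    ultimately show ?thesis by simp
  qed
  then show ?thesis
    using assms by (simp add: card_bdry_bonds card_lat_box sum_divide_distrib del: of_nat_prod)
qed

lemma shift_in_lat_box: "n \<in> lat_box d L \<Longrightarrow> i < d \<Longrightarrow> n i < L i \<Longrightarrow> shift n i \<in> lat_box d L"
  by (auto simp: lat_box_def shift_def)

lemma tshift_in_lat_box: "n \<in> lat_box d M \<Longrightarrow> i < d \<Longrightarrow> tshift M n i \<in> lat_box d M"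
  by (auto simp: lat_box_def tshift_def)

lemma abs_bond_spin:
  assumes "\<sigma> \<in> configs S" "fst b \<in> S" "h b \<in> S"
  shows "\<bar>bond_spin h b \<sigma>\<bar> = 1"
  using assms by (simp add: bond_spin_def abs_mult abs_config)

lemma spin_system_free: "spin_system (configs (lat_box d L)) (free_bonds d L) free_spin"
proof
  show "\<bar>free_spin b \<sigma>\<bar> = 1" if "b \<in> free_bonds d L" "\<sigma> \<in> configs (lat_box d L)" for b \<sigma>
    using that by (intro abs_bond_spin[of \<sigma> "lat_box d L"]) (auto simp: free_bonds_def shift_in_lat_box)
qed (auto intro: finite_configs finite_lat_box finite_free_bonds simp: configs_nonempty)

lemma spin_system_torus: "spin_system (configs (lat_box d M)) (torus_bonds d M) (torus_spin M)"
proof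
  show "\<bar>torus_spin M b \<sigma>\<bar> = 1" if "b \<in> torus_bonds d M" "\<sigma> \<in> configs (lat_box d M)" for b \<sigma>
    using that by (intro abs_bond_spin[of \<sigma> "lat_box d M"]) (auto simp: torus_bonds_def tshift_in_lat_box)
qed (auto intro: finite_configs finite_lat_box finite_torus_bonds simp: configs_nonempty)

lemma P_free_eq: "P_free d L = q_pressure (configs (lat_box d L)) (free_bonds d L) free_spin (\<lambda>_. 1)"
  by (simp add: P_free_def Z_free_def q_pressure_def partf_def energy_def bond_spin_def mult_ac)

subsection \<open>Block decomposition\<close>

text \<open>The factor may depend on the direction, unlike in \<open>magnify\<close>: two boxes
  \<open>L\<close> and \<open>L'\<close> tile the torus with sides \<open>L i * L' i\<close>, each
  acting as the factor of the other.\<close>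

definition stretch :: "(nat \<Rightarrow> nat) \<Rightarrow> (nat \<Rightarrow> nat) \<Rightarrow> nat \<Rightarrow> nat" where
  "stretch K L i = K i * L i"

text \<open>Indices start at 0, so that index 0 is the box itself; as for sites, coordinates from
  \<open>d\<close> on are 0, which makes the index unique.\<close>

definition blocks :: "nat \<Rightarrow> (nat \<Rightarrow> nat) \<Rightarrow> (nat \<Rightarrow> nat) set" where
  "blocks d K = PiE_dflt {..<d} 0 (\<lambda>i. {..<K i})"

definition translate :: "(nat \<Rightarrow> nat) \<Rightarrow> (nat \<Rightarrow> nat) \<Rightarrow> site \<Rightarrow> site" where
  "translate L q n i = n i + q i * L i"

text \<open>The bonds leaving the upper faces of the blocks, those wrapping around the torus
  included; these are the bonds to which \<open>tweight\<close> gives weight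
  \<open>t\<close>.\<close>

definition cross_bonds :: "nat \<Rightarrow> (nat \<Rightarrow> nat) \<Rightarrow> (nat \<Rightarrow> nat) \<Rightarrow> bond set" where
  "cross_bonds d K L = {b \<in> torus_bonds d (stretch K L). L (snd b) dvd fst b (snd b)}"

lemma finite_blocks: "finite (blocks d K)"
  unfolding blocks_def by (rule finite_PiE_dflt) auto

lemma card_blocks: "card (blocks d K) = (\<Prod>i<d. K i)"
  unfolding blocks_def by (subst card_PiE_dflt) auto

text \<open>Sites in a block run from 1 to \<open>l\<close>, so 1 is subtracted before dividing;
  otherwise the last site would be assigned to the next block.\<close>

lemma block_coordinate:
  assumes "1 \<le> a" "a \<le> l"
  shows "(a + q * l - 1) div l = q" "(a + q * l - 1) mod l + 1 = (a::nat)"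
proof -
  obtain c where c: "a = Suc c" "c < l" using assms by (cases a) auto
  then show "(a + q * l - 1) div l = q" "(a + q * l - 1) mod l + 1 = a"
    by auto
qed

lemma blocks_le: "q \<in> blocks d K \<Longrightarrow> i < d \<Longrightarrow> a \<le> L i \<Longrightarrow> a + q i * L i \<le> K i * L i"
proof -
  assume "q \<in> blocks d K" "i < d" and a: "a \<le> L i"
  then have "Suc (q i) \<le> K i" by (auto simp: blocks_def PiE_dflt_def)
  then have "Suc (q i) * L i \<le> K i * L i" by (rule mult_right_mono) simp
  then show ?thesis using a by simp
qed

lemma blocks_zero: "q \<in> blocks d K \<Longrightarrow> i \<ge> d \<Longrightarrow> q i = 0"
  by (simp add: blocks_def PiE_dflt_def)

lemma translate_in_box:
  assumes "q \<in> blocks d K" "n \<in> lat_box d L"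
  shows "translate L q n \<in> lat_box d (stretch K L)"
  using assms blocks_le[OF assms(1)] blocks_zero[OF assms(1)]
  by (auto simp: lat_box_def translate_def stretch_def intro: trans_le_add1)

lemma inj_translate: "inj (translate L q)"
  by (auto simp: inj_def translate_def fun_eq_iff)

lemma translate_inj2:
  assumes "q \<in> blocks d K" "q' \<in> blocks d K" "n \<in> lat_box d L" "n' \<in> lat_box d L"
    and eq: "translate L q n = translate L q' n'"
  shows "q = q'"
proof
  fix i
  show "q i = q' i"
  proof (cases "i < d")
    case True
    have "n i + q i * L i = n' i + q' i * L i"
      using fun_cong[OF eq, of i] by (simp add: translate_def)
    then show ?thesis
      using True assms(3,4) block_coordinate(1)[of "n i" "L i" "q i"]
        block_coordinate(1)[of "n' i" "L i" "q' i"]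
      by (auto simp: lat_box_def)
  next
    case False
    then show ?thesis using blocks_zero[OF assms(1), of i] blocks_zero[OF assms(2), of i] by simp
  qed
qed

lemma coordinate_decompose: "1 \<le> a \<Longrightarrow> a = ((a - 1) mod l + 1) + (a - 1) div l * (l::nat)"
  by (cases a) auto

lemma lat_box_decompose:
  assumes L: "\<forall>i<d. L i \<ge> 1" and m: "m \<in> lat_box d (stretch K L)"
  obtains q n where "q \<in> blocks d K" "n \<in> lat_box d L" "m = translate L q n"
proof
  let ?q = "\<lambda>i. if i < d then (m i - 1) div L i else 0"
  let ?n = "\<lambda>i. if i < d then (m i - 1) mod L i + 1 else 0"
  have m1: "1 \<le> m i" "m i \<le> K i * L i" if "i < d" for i
    using m that by (auto simp: lat_box_def stretch_def)
  show "?q \<in> blocks d K"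
  proof -
    have "(m i - 1) div L i < K i" if "i < d" for i
    proof (rule less_mult_imp_div_less)
      show "m i - 1 < K i * L i" using m1[OF that] by simp
    qed
    then show ?thesis by (auto simp: blocks_def PiE_dflt_def)
  qed
  show "?n \<in> lat_box d L"
  proof -
    have "(m i - 1) mod L i < L i" if "i < d" for i
      using L that by (intro mod_less_divisor) (auto simp: Suc_le_eq)
    then show ?thesis by (auto simp: lat_box_def Suc_le_eq)
  qed
  have "m i = translate L ?q ?n i" for i
  proof (cases "i < d")
    case True
    then show ?thesis
      using coordinate_decompose[OF m1(1)[OF True], of "L i"] by (simp only: translate_def if_True)
  next
    case False
    with m show ?thesis by (simp add: lat_box_def translate_def)
  qed
  then show "m = translate L ?q ?n" by blast
qed

abbreviation translate_bond :: "(nat \<Rightarrow> nat) \<Rightarrow> (nat \<Rightarrow> nat) \<Rightarrow> bond \<Rightarrow> bond" where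
  "translate_bond L q \<equiv> map_prod (translate L q) id"

lemma lat_box_blocks:
  assumes "\<forall>i<d. L i \<ge> 1"
  shows "lat_box d (stretch K L) = (\<Union>q\<in>blocks d K. translate L q ` lat_box d L)"
proof (intro set_eqI iffI)
  fix m assume "m \<in> lat_box d (stretch K L)"
  then show "m \<in> (\<Union>q\<in>blocks d K. translate L q ` lat_box d L)"
    by (rule lat_box_decompose[OF assms]) blast
qed (auto intro: translate_in_box)

lemma dvd_translate:
  assumes "n \<in> lat_box d L" "i < d"
  shows "L i dvd translate L q n i \<longleftrightarrow> n i = L i"
proof -
  have "L i dvd translate L q n i \<longleftrightarrow> L i dvd n i"
    by (simp add: translate_def)
  also have "\<dots> \<longleftrightarrow> n i = L i"
    using assms dvd_imp_le[of "L i" "n i"] by (auto simp: lat_box_def Suc_le_eq)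
  finally show ?thesis .
qed

text \<open>A bond belongs to the block of its starting site. In the direction of the bond the
  coordinate runs there through one full period, so divisibility singles out exactly the upper
  face.\<close>

lemma cross_bonds_blocks:
  assumes L: "\<forall>i<d. L i \<ge> 1"
  shows "cross_bonds d K L = (\<Union>q\<in>blocks d K. translate_bond L q ` bdry_bonds d L)"
    and "torus_bonds d (stretch K L) - cross_bonds d K L
      = (\<Union>q\<in>blocks d K. translate_bond L q ` free_bonds d L)"
proof -
  have T: "torus_bonds d (stretch K L) = (\<Union>q\<in>blocks d K. translate_bond L q ` torus_bonds d L)"
    unfolding torus_bonds_eq lat_box_blocks[OF L] by force
  define P where "P b \<longleftrightarrow> L (snd b) dvd fst b (snd b)" for b :: bond
  have P: "P (translate_bond L q b) \<longleftrightarrow> b \<in> bdry_bonds d L" if "b \<in> torus_bonds d L" for b q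
    using that dvd_translate[of "fst b" d L "snd b" q]
    by (auto simp: P_def torus_bonds_def bdry_bonds_def)
  have image: "f ` A \<inter> Collect P = f ` {a \<in> A. P (f a)}" "f ` A - Collect P = f ` {a \<in> A. \<not> P (f a)}"
    for f :: "bond \<Rightarrow> bond" and A by blast+
  have bdry: "{b \<in> torus_bonds d L. P (translate_bond L q b)} = bdry_bonds d L" for q
    using P[of _ q] bdry_bonds_subset[of d L] by blast
  have free: "{b \<in> torus_bonds d L. \<not> P (translate_bond L q b)} = free_bonds d L" for q
  proof -
    have "free_bonds d L = torus_bonds d L - bdry_bonds d L"
      by (auto simp: torus_bonds_def bdry_bonds_def free_bonds_def lat_box_def)
    then show ?thesis using P[of _ q] by blast
  qed
  have cross: "cross_bonds d K L = torus_bonds d (stretch K L) \<inter> Collect P"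
    by (auto simp: cross_bonds_def P_def)
  show "cross_bonds d K L = (\<Union>q\<in>blocks d K. translate_bond L q ` bdry_bonds d L)"
    unfolding cross T by (simp only: UN_simps[symmetric] image(1) bdry)
  show "torus_bonds d (stretch K L) - cross_bonds d K L
      = (\<Union>q\<in>blocks d K. translate_bond L q ` free_bonds d L)"
    unfolding cross Diff_Int Diff_cancel Un_empty_left T by (simp only: UN_simps[symmetric] image(2) free)
qed

lemma inj_translate_bond: "inj (translate_bond L q)"
  using prod.inj_map[OF inj_translate[of L q] inj_on_id] .

lemma disjoint_translate:
  "disjoint_family_on (\<lambda>q. translate L q ` lat_box d L) (blocks d K)"
  unfolding disjoint_family_on_def using translate_inj2 by blast

lemma disjoint_translate_bond:
  assumes "A \<subseteq> torus_bonds d L"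
  shows "disjoint_family_on (\<lambda>q. translate_bond L q ` A) (blocks d K)"
  unfolding disjoint_family_on_def
proof (intro ballI impI)
  fix p q assume "p \<in> blocks d K" "q \<in> blocks d K" "p \<noteq> q"
  then show "translate_bond L p ` A \<inter> translate_bond L q ` A = {}"
    using assms translate_inj2[of p d K q _ L] by (fastforce simp: torus_bonds_eq)
qed

lemma card_cross_bonds:
  assumes "\<forall>i<d. L i \<ge> 1"
  shows "card (cross_bonds d K L) = card (blocks d K) * card (bdry_bonds d L)"
proof -
  have "card (cross_bonds d K L) = (\<Sum>q\<in>blocks d K. card (translate_bond L q ` bdry_bonds d L))"
    unfolding cross_bonds_blocks(1)[OF assms]
    using disjoint_translate_bond[OF bdry_bonds_subset]
    by (intro card_UN_disjoint) (auto simp: finite_blocks finite_bdry_bonds disjoint_family_on_def)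
  also have "\<dots> = (\<Sum>q\<in>blocks d K. card (bdry_bonds d L))"
    by (intro sum.cong refl card_image inj_on_subset[OF inj_translate_bond]) auto
  finally show ?thesis by simp
qed

text \<open>A bond starting below the upper face of its block ends in the same block, so no
  wrap-around occurs and it is a translated free bond.\<close>

lemma tshift_translate:
  assumes "q \<in> blocks d K" "n \<in> lat_box d L" "i < d" "n i < L i"
  shows "tshift (stretch K L) (translate L q n) i = translate L q (shift n i)"
proof -
  have "translate L q n i < stretch K L i"
    using blocks_le[OF assms(1,3), of "Suc (n i)" L] assms(4) by (simp add: translate_def stretch_def)
  then show ?thesis
    by (auto simp: tshift_def shift_def translate_def fun_eq_iff)
qed

text \<open>Without the couplings across block boundaries, the partition function of the large torus is
  the product of the free partition functions of the blocks.\<close>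

lemma q_pressure_torus_cut:
  fixes K L :: "nat \<Rightarrow> nat"
  assumes L: "\<forall>i<d. L i \<ge> 1"
  defines "M \<equiv> stretch K L"
  shows "q_pressure (configs (lat_box d M)) (torus_bonds d M) (torus_spin M)
      (interp_weight (cross_bonds d K L) 0) = card (blocks d K) * P_free d L"
proof -
  let ?w = "interp_weight (cross_bonds d K L) 0"
  let ?Z = "\<lambda>q J. partf (configs (translate L q ` lat_box d L)) (translate_bond L q ` free_bonds d L)
      (torus_spin M) (\<lambda>b. ?w b * J b)"
  interpret T: spin_system "configs (lat_box d M)" "torus_bonds d M" "torus_spin M"
    by (rule spin_system_torus)
  interpret F: spin_system "configs (lat_box d L)" "free_bonds d L" free_spin
    by (rule spin_system_free)
  have pos: "?Z q J > 0" for q J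
    unfolding partf_def
    by (intro sum_pos finite_configs configs_nonempty) (auto simp: finite_lat_box)
  have spin: "torus_spin M (translate_bond L q b) \<sigma> = \<sigma> (translate L q (fst b)) * \<sigma> (translate L q (shift (fst b) (snd b)))"
    if "q \<in> blocks d K" "b \<in> free_bonds d L" for q b \<sigma>
    using that tshift_translate[of q d K "fst b" L "snd b"]
    by (auto simp: bond_spin_def free_bonds_def M_def)
  have shift: "shift (fst b) (snd b) \<in> lat_box d L" "fst b \<in> lat_box d L" if "b \<in> free_bonds d L" for b
    using that shift_in_lat_box by (auto simp: free_bonds_def)
  have spin_local: "local_spin (translate L q ` lat_box d L) (torus_spin M b)"
    if q: "q \<in> blocks d K" and b: "b \<in> translate_bond L q ` free_bonds d L" for q b
  proof -
    from b obtain c where c: "b = translate_bond L q c" "c \<in> free_bonds d L"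
      by (rule imageE)
    show ?thesis
      unfolding local_spin_def c(1) spin[OF q c(2)] using shift[OF c(2)] by simp
  qed
  have noncross: "torus_bonds d M - cross_bonds d K L
      = (\<Union>q\<in>blocks d K. translate_bond L q ` free_bonds d L)"
    unfolding M_def by (rule cross_bonds_blocks(2)[OF L])
  have w: "?w (translate_bond L q b) = 1" if "q \<in> blocks d K" "b \<in> free_bonds d L" for q b
    using that noncross by (force simp: interp_weight_def)
  \<comment> \<open>Each block is a translated copy of the free box; the couplings of all other
    torus bonds integrate out.\<close>
  have embed: "integrable (gauss_prod (torus_bonds d M)) (\<lambda>J. ln (?Z q J))"
    "gauss_av (torus_bonds d M) (\<lambda>J. ln (?Z q J)) = P_free d L" if q: "q \<in> blocks d K" for q
  proof -
    let ?g = "translate_bond L q"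
    let ?F = "\<lambda>\<sigma>. \<lambda>n\<in>translate L q ` lat_box d L. \<sigma> (inv_into (lat_box d L) (translate L q) n)"
    have g: "inj_on ?g (free_bonds d L)" "?g \<in> free_bonds d L \<rightarrow> torus_bonds d M"
      using inj_on_subset[OF inj_translate_bond] q noncross by blast+
    have F: "bij_betw ?F (configs (lat_box d L)) (configs (translate L q ` lat_box d L))"
      by (intro bij_betw_configs inj_on_imp_bij_betw inj_on_subset[OF inj_translate]) simp
    have s': "torus_spin M (?g b) (?F \<sigma>) = free_spin b \<sigma>" if "b \<in> free_bonds d L" "\<sigma> \<in> configs (lat_box d L)" for b \<sigma>
      unfolding spin[OF q that(1)] using shift[OF that(1)]
      by (simp add: bond_spin_def inv_into_f_f inj_on_subset[OF inj_translate])
    show "integrable (gauss_prod (torus_bonds d M)) (\<lambda>J. ln (?Z q J))"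
      by (rule F.q_pressure_embed(1)[where g = ?g and F = ?F and w = "\<lambda>_. 1", OF g F])
         (rule s' w[OF q]; assumption)+
    show "gauss_av (torus_bonds d M) (\<lambda>J. ln (?Z q J)) = P_free d L"
      unfolding P_free_eq
      by (rule F.q_pressure_embed(2)[where g = ?g and F = ?F and w = "\<lambda>_. 1", OF g F])
         (rule s' w[OF q]; assumption)+
  qed
  \<comment> \<open>Zero weights remove the crossing bonds, and what remains splits into blocks with
    disjoint sites and bonds.\<close>
  have "partf (configs (lat_box d M)) (torus_bonds d M) (torus_spin M) (\<lambda>b. ?w b * J b)
      = (\<Prod>q\<in>blocks d K. ?Z q J)" for J
  proof -
    have "partf (configs (lat_box d M)) (torus_bonds d M) (torus_spin M) (\<lambda>b. ?w b * J b)
        = partf (configs (lat_box d M)) (torus_bonds d M - cross_bonds d K L) (torus_spin M) (\<lambda>b. ?w b * J b)"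
      by (rule partf_zero_weight) (auto simp: finite_torus_bonds interp_weight_def)
    also have "\<dots> = partf (configs (\<Union>q\<in>blocks d K. translate L q ` lat_box d L))
        (\<Union>q\<in>blocks d K. translate_bond L q ` free_bonds d L) (torus_spin M) (\<lambda>b. ?w b * J b)"
      using noncross lat_box_blocks[OF L, of K] by (simp only: M_def)
    also have "\<dots> = (\<Prod>q\<in>blocks d K. ?Z q J)"
    proof -
      have fin: "finite (translate_bond L q ` free_bonds d L)" for q
        by (intro finite_imageI finite_free_bonds)
      show ?thesis
        by (rule partf_disjoint_UN[OF finite_blocks fin disjoint_translate
              disjoint_translate_bond[OF free_bonds_subset] spin_local])
    qed
    finally show ?thesis .
  qed
  moreover have "ln (\<Prod>q\<in>blocks d K. ?Z q J) = (\<Sum>q\<in>blocks d K. ln (?Z q J))" for J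
    by (intro ln_prod finite_blocks pos[THEN less_imp_neq, THEN not_sym])
  ultimately have "q_pressure (configs (lat_box d M)) (torus_bonds d M) (torus_spin M) ?w
      = gauss_av (torus_bonds d M) (\<lambda>J. \<Sum>q\<in>blocks d K. ln (?Z q J))"
    by (simp only: q_pressure_def)
  also have "\<dots> = (\<Sum>q\<in>blocks d K. gauss_av (torus_bonds d M) (\<lambda>J. ln (?Z q J)))"
    unfolding gauss_av_def by (intro Bochner_Integration.integral_sum embed)
  also have "\<dots> = (\<Sum>q\<in>blocks d K. P_free d L)"
    by (intro sum.cong embed refl)
  finally show ?thesis by simp
qed

subsection \<open>The infinite-volume limit\<close>

definition P_torus :: "nat \<Rightarrow> (nat \<Rightarrow> nat) \<Rightarrow> real" where
  "P_torus d M = q_pressure (configs (lat_box d M)) (torus_bonds d M) (torus_spin M) (\<lambda>_. 1)"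

text \<open>Half the number of boundary bonds per site, by \<open>card_bdry_bonds_quotient\<close>:
  the bound on the change of pressure per site caused by cutting.\<close>

definition bdry_ratio :: "nat \<Rightarrow> (nat \<Rightarrow> nat) \<Rightarrow> real" where
  "bdry_ratio d L = (\<Sum>i<d. 1 / real (L i)) / 2"

lemma cross_bonds_subset: "cross_bonds d K L \<subseteq> torus_bonds d (stretch K L)"
  by (auto simp: cross_bonds_def)

lemma stretch_commute: "stretch K L = stretch L K"
  by (simp add: stretch_def fun_eq_iff)

lemma card_lat_box_stretch:
  "card (lat_box d (stretch K L)) = card (blocks d K) * card (lat_box d L)"
  by (simp add: card_lat_box card_blocks stretch_def prod.distrib)

lemma card_lat_box_pos: "\<forall>i<d. L i \<ge> 1 \<Longrightarrow> card (lat_box d L) > 0"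
  by (auto simp: card_lat_box intro!: prod_pos)

lemma card_blocks_pos: "\<forall>i<d. K i \<ge> 1 \<Longrightarrow> card (blocks d K) > 0"
  by (auto simp: card_blocks intro!: prod_pos)

lemma P_torus_bounds:
  assumes "\<forall>i<d. L i \<ge> 1"
  shows "card (blocks d K) * P_free d L \<le> P_torus d (stretch K L)"
    and "P_torus d (stretch K L)
      \<le> card (blocks d K) * P_free d L + card (blocks d K) * card (bdry_bonds d L) / 2"
proof -
  let ?M = "stretch K L"
  interpret T: spin_system "configs (lat_box d ?M)" "torus_bonds d ?M" "torus_spin ?M"
    by (rule spin_system_torus)
  have 1: "interp_weight D 1 = (\<lambda>_. 1)" for D :: "bond set"
    by (simp add: interp_weight_def fun_eq_iff)
  show "card (blocks d K) * P_free d L \<le> P_torus d (stretch K L)"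
    and "P_torus d (stretch K L)
      \<le> card (blocks d K) * P_free d L + card (blocks d K) * card (bdry_bonds d L) / 2"
    using T.q_pressure_cut_bounds[OF cross_bonds_subset]
    by (simp_all add: 1 P_torus_def[symmetric] q_pressure_torus_cut[OF assms] card_cross_bonds[OF assms])
qed

text \<open>Sites and cut bonds are both proportional to the number of blocks, so the error per site
  depends on \<open>L\<close> and not on \<open>K\<close>. This uniformity allows \<open>K\<close>
  to be another box.\<close>

lemma P_torus_P_free_density:
  assumes L: "\<forall>i<d. L i \<ge> 1" and K: "\<forall>i<d. K i \<ge> 1"
  shows "\<bar>P_torus d (stretch K L) / card (lat_box d (stretch K L)) - P_free d L / card (lat_box d L)\<bar>
    \<le> bdry_ratio d L"
proof -
  define N V c where "N = real (card (blocks d K))" and "V = real (card (lat_box d L))"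
    and "c = real (card (bdry_bonds d L))"
  have pos: "N > 0" "V > 0"
    using card_blocks_pos[OF K] card_lat_box_pos[OF L] by (simp_all add: N_def V_def)
  have h: "bdry_ratio d L = c / V / 2"
    unfolding bdry_ratio_def c_def V_def by (simp only: card_bdry_bonds_quotient[OF L])
  have "0 \<le> P_torus d (stretch K L) - N * P_free d L"
    "P_torus d (stretch K L) - N * P_free d L \<le> N * c / 2"
    using P_torus_bounds[OF L, of K] by (simp_all add: N_def c_def)
  then have "\<bar>(P_torus d (stretch K L) - N * P_free d L) / (N * V)\<bar> \<le> (N * c / 2) / (N * V)"
    unfolding abs_divide using pos by (intro frac_le) auto
  moreover have "(P_torus d (stretch K L) - N * P_free d L) / (N * V)
      = P_torus d (stretch K L) / (N * V) - P_free d L / V"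
    using pos by (simp add: diff_divide_distrib)
  moreover have "(N * c / 2) / (N * V) = c / V / 2"
    using pos by (simp add: field_simps)
  ultimately show ?thesis
    unfolding h card_lat_box_stretch of_nat_mult N_def[symmetric] V_def[symmetric]
    by (simp only:)
qed

text \<open>Both boxes tile the torus whose sides are the products of their sides.\<close>

lemma P_free_density_diff:
  assumes "\<forall>i<d. L i \<ge> 1" "\<forall>i<d. L' i \<ge> 1"
  shows "\<bar>P_free d L / card (lat_box d L) - P_free d L' / card (lat_box d L')\<bar>
    \<le> bdry_ratio d L + bdry_ratio d L'"
  using P_torus_P_free_density[OF assms] P_torus_P_free_density[OF assms(2,1)]
  by (simp add: stretch_commute[of L' L])

lemma bdry_ratio_const: "bdry_ratio d (\<lambda>_. n) = real d / 2 / real n"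
  by (simp add: bdry_ratio_def)

lemma bdry_ratio_le:
  assumes "N \<ge> 1" "\<forall>i<d. N \<le> L i"
  shows "bdry_ratio d L \<le> real d / 2 / real N"
proof -
  have "(\<Sum>i<d. 1 / real (L i)) \<le> (\<Sum>i<d. 1 / real N)"
    using assms by (intro sum_mono divide_left_mono) (auto intro!: mult_pos_pos)
  then show ?thesis by (simp add: bdry_ratio_def)
qed

section \<open>Existence of the pressure and its transfer to tori\<close>

lemma all_sides_to_infinity_neq_bot: "all_sides_to_infinity d \<noteq> bot"
proof -
  have "\<not> eventually (\<lambda>_. False) (all_sides_to_infinity d)"
    unfolding all_sides_to_infinity_def
  proof (subst eventually_INF_base)
    fix a b :: nat
    show "\<exists>x\<in>UNIV. principal {L. \<forall>i<d. x \<le> L i}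
        \<le> inf (principal {L. \<forall>i<d. a \<le> L i}) (principal {L. \<forall>i<d. b \<le> L i})"
      by (intro bexI[of _ "max a b"]) auto
    show "\<not> (\<exists>N\<in>UNIV. eventually (\<lambda>_. False) (principal {L :: nat \<Rightarrow> nat. \<forall>i<d. N \<le> L i}))"
    proof -
      have "\<exists>L. \<forall>i<d. N \<le> L i" for N :: nat
        by (rule exI[of _ "\<lambda>_. N"]) simp
      then show ?thesis by (simp add: eventually_principal)
    qed
  qed simp
  then show ?thesis by (simp add: trivial_limit_def)
qed

lemma eventually_all_sides: "eventually (\<lambda>L. \<forall>i<d. N \<le> L i) (all_sides_to_infinity d)"
  unfolding all_sides_to_infinity_def
  by (rule eventually_INF1[of N]) (auto simp: eventually_principal)

text \<open>Cubes give a Cauchy sequence with some limit p. Comparing a box with the n-th cube and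
  letting n grow leaves only the error of the box itself; this bound implies convergence to p along
  the filter, and since the filter is proper, \<open>Lim\<close> returns p.\<close>

lemma P_free_density_pressure:
  assumes L: "\<forall>i<d. L i \<ge> 1"
  shows "\<bar>P_free d L / card (lat_box d L) - pressure d\<bar> \<le> bdry_ratio d L"
proof -
  define a where "a L = P_free d L / card (lat_box d L)" for L
  define x where "x n = a (\<lambda>_. Suc n)" for n
  have diff: "\<bar>a L - a L'\<bar> \<le> bdry_ratio d L + bdry_ratio d L'"
    if "\<forall>i<d. L i \<ge> 1" "\<forall>i<d. L' i \<ge> 1" for L L'
    unfolding a_def by (rule P_free_density_diff[OF that])
  have diff_x: "\<bar>a L - x n\<bar> \<le> bdry_ratio d L + real d / 2 / real (Suc n)"
    if "\<forall>i<d. L i \<ge> 1" for L n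
    unfolding x_def bdry_ratio_const[symmetric] by (rule diff[OF that]) simp
  have null: "(\<lambda>n. real d / 2 / real (Suc n)) \<longlonglongrightarrow> 0"
    by real_asymp
  have "Cauchy x"
  proof (rule CauchyI')
    fix e :: real assume "e > 0"
    then obtain N where N: "real d / 2 / real (Suc n) < e / 2" if "n \<ge> N" for n
      using order_tendstoD(2)[OF null, of "e / 2"] by (auto simp: eventually_sequentially)
    have "dist (x m) (x n) < e" if "m \<ge> N" "n > m" for m n
    proof -
      have "\<bar>x m - x n\<bar> \<le> real d / 2 / real (Suc m) + real d / 2 / real (Suc n)"
        using diff_x[of "\<lambda>_. Suc m" n] unfolding x_def bdry_ratio_const by simp
      then show ?thesis
        using N[of m] N[of n] that unfolding dist_real_def by linarith
    qed
    then show "\<exists>M. \<forall>m\<ge>M. \<forall>n>m. dist (x m) (x n) < e" by blast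
  qed
  then obtain p where p: "x \<longlonglongrightarrow> p"
    by (auto simp: Cauchy_convergent_iff convergent_def)
  have bound: "\<bar>a L - p\<bar> \<le> bdry_ratio d L" if L: "\<forall>i<d. L i \<ge> 1" for L
  proof (rule LIMSEQ_le)
    show "(\<lambda>n. \<bar>a L - x n\<bar>) \<longlonglongrightarrow> \<bar>a L - p\<bar>"
      by (intro tendsto_intros p)
    show "(\<lambda>n. bdry_ratio d L + real d / 2 / real (Suc n)) \<longlonglongrightarrow> bdry_ratio d L"
      using tendsto_add[OF tendsto_const null, of "bdry_ratio d L"] by simp
    show "\<exists>N. \<forall>n\<ge>N. \<bar>a L - x n\<bar> \<le> bdry_ratio d L + real d / 2 / real (Suc n)"
      using diff_x[OF L] by blast
  qed
  have "(a \<longlongrightarrow> p) (all_sides_to_infinity d)"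
  proof (rule tendstoI)
    fix e :: real assume "e > 0"
    then obtain N where N: "real d / 2 / real (Suc N) < e"
      using order_tendstoD(2)[OF null, of e] by (auto simp: eventually_sequentially)
    show "eventually (\<lambda>L. dist (a L) p < e) (all_sides_to_infinity d)"
      using eventually_all_sides[of d "Suc N"]
    proof eventually_elim
      fix L assume L: "\<forall>i<d. Suc N \<le> L i"
      then have "\<bar>a L - p\<bar> \<le> bdry_ratio d L"
        by (intro bound) auto
      also have "\<dots> \<le> real d / 2 / real (Suc N)"
        by (rule bdry_ratio_le[OF _ L]) simp
      also note N
      finally show "dist (a L) p < e" by (simp add: dist_real_def)
    qed
  qed
  then have "pressure d = p"
    unfolding pressure_def a_def by (rule tendsto_Lim[OF all_sides_to_infinity_neq_bot])
  then show ?thesis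
    using bound[OF L] by (simp add: a_def)
qed

text \<open>The torus is compared with the free box of the same sides, and that box with the limit.
  Each comparison costs \<open>bdry_ratio\<close> of the magnified box, which is that of
  \<open>L\<close> divided by \<open>k\<close>; hence the 2.\<close>

lemma P_torus_density_tendsto_pressure:
  assumes L: "\<forall>i<d. L i \<ge> 1"
  shows "(\<lambda>k. P_torus d (stretch (\<lambda>_. k) L) / card (blocks d (\<lambda>_. k))) \<longlonglongrightarrow> pressure d * card (lat_box d L)"
proof -
  define V where "V = real (card (lat_box d L))"
  have V: "V > 0" using card_lat_box_pos[OF L] by (simp add: V_def)
  let ?M = "\<lambda>k. stretch (\<lambda>_. k) L"
  have "(\<lambda>k. P_torus d (?M k) / card (lat_box d (?M k))) \<longlonglongrightarrow> pressure d"
  proof (rule LIM_zero_cancel, rule Lim_null_comparison)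
    show "(\<lambda>k. 2 * bdry_ratio d L / real k) \<longlonglongrightarrow> 0"
      by (rule lim_const_over_n)
    show "\<forall>\<^sub>F k in sequentially. norm (P_torus d (?M k) / card (lat_box d (?M k)) - pressure d)
        \<le> 2 * bdry_ratio d L / real k"
      using eventually_ge_at_top[of 1]
    proof eventually_elim
      fix k :: nat assume k: "k \<ge> 1"
      have M: "\<forall>i<d. ?M k i \<ge> 1"
        using L k by (auto simp: stretch_def Suc_le_eq)
      \<comment> \<open>One block in every direction: the torus is cut into a single free box of its
        own size.\<close>
      have "stretch (\<lambda>_. 1) (?M k) = ?M k"
        by (simp add: stretch_def fun_eq_iff)
      then have "\<bar>P_torus d (?M k) / card (lat_box d (?M k)) - P_free d (?M k) / card (lat_box d (?M k))\<bar>
          \<le> bdry_ratio d (?M k)"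
        using P_torus_P_free_density[OF M, of "\<lambda>_. 1"] by simp
      moreover have "bdry_ratio d (?M k) = bdry_ratio d L / real k"
        by (simp add: bdry_ratio_def stretch_def sum_divide_distrib mult_ac)
      ultimately show "norm (P_torus d (?M k) / card (lat_box d (?M k)) - pressure d)
          \<le> 2 * bdry_ratio d L / real k"
        using P_free_density_pressure[OF M] by simp
    qed
  qed
  then have "(\<lambda>k. P_torus d (?M k) / card (lat_box d (?M k)) * V) \<longlonglongrightarrow> pressure d * V"
    by (intro tendsto_mult tendsto_const)
  then show ?thesis
    using V by (simp add: card_lat_box_stretch V_def)
qed

subsection \<open>Translation invariance on the torus\<close>

text \<open>Translation by \<open>c\<close> on the torus. Coordinates start at 1, so the residue is
  taken after subtracting 1. It agrees with \<open>translate\<close> as long as nothing wraps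
  around.\<close>

definition rotate_site :: "nat \<Rightarrow> (nat \<Rightarrow> nat) \<Rightarrow> (nat \<Rightarrow> nat) \<Rightarrow> site \<Rightarrow> site" where
  "rotate_site d M c n i = (if i < d then (n i - 1 + c i) mod M i + 1 else 0)"

lemma rotate_coordinate_inj:
  assumes "1 \<le> a" "a \<le> m" "1 \<le> b" "b \<le> m" "(a - 1 + c) mod m = (b - 1 + c) mod (m::nat)"
  shows "a = b"
proof -
  have *: "b \<le> a" if "1 \<le> a" "a \<le> b" "b \<le> m" "(a - 1 + c) mod m = (b - 1 + c) mod m" for a b
  proof -
    have "m dvd (b - 1 + c) - (a - 1 + c)"
      using that mod_eq_dvd_iff_nat[of "a - 1 + c" "b - 1 + c" m] by simp
    then have "m dvd b - a" using that by simp
    then show ?thesis using that dvd_imp_le[of m "b - a"] by (cases "b - a = 0") auto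
  qed
  show ?thesis
    using *[of a b] *[of b a] assms by (cases "a \<le> b") auto
qed

lemma bij_rotate_site: "bij_betw (rotate_site d M c) (lat_box d M) (lat_box d M)"
proof -
  have maps: "rotate_site d M c ` lat_box d M \<subseteq> lat_box d M"
  proof (intro image_subsetI)
    fix n assume n: "n \<in> lat_box d M"
    have "(n i - 1 + c i) mod M i < M i" if "i < d" for i
      using n that by (intro mod_less_divisor) (auto simp: lat_box_def Suc_le_eq intro: less_le_trans)
    then show "rotate_site d M c n \<in> lat_box d M"
      by (auto simp: lat_box_def rotate_site_def Suc_le_eq)
  qed
  have inj: "inj_on (rotate_site d M c) (lat_box d M)"
  proof (intro inj_onI ext)
    fix n n' i
    assume n: "n \<in> lat_box d M" "n' \<in> lat_box d M" "rotate_site d M c n = rotate_site d M c n'"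
    show "n i = n' i"
    proof (cases "i < d")
      case True
      then show ?thesis
        using n(1,2) fun_cong[OF n(3), of i]
        by (intro rotate_coordinate_inj[of "n i" "M i" "n' i" "c i"])
           (auto simp: lat_box_def rotate_site_def)
    next
      case False
      then show ?thesis using n by (simp add: lat_box_def)
    qed
  qed
  show ?thesis
    using endo_inj_surj[OF finite_lat_box maps inj] inj by (simp add: bij_betw_def)
qed

text \<open>Commuting with the step to a neighbour is what makes a rotation an automorphism of the
  bond structure.\<close>

lemma rotate_site_tshift:
  assumes "n \<in> lat_box d M" "i < d"
  shows "rotate_site d M c (tshift M n i) = tshift M (rotate_site d M c n) i"
proof
  fix j
  show "rotate_site d M c (tshift M n i) j = tshift M (rotate_site d M c n) i j"
  proof (cases "j = i")
    case True
    obtain a where a: "n i = Suc a"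
      using assms by (cases "n i") (auto simp: lat_box_def)
    \<comment> \<open>A wrapping step resets the coordinate to 1, that is to 0 after subtracting 1,
      which agrees modulo \<open>M i\<close> with increasing it by 1.\<close>
    have "(if n i = M i then c i else n i + c i) mod M i = Suc (a + c i) mod M i"
    proof (cases "n i = M i")
      case True
      have "c i mod M i = (M i + c i) mod M i" by simp
      also have "M i + c i = Suc (a + c i)" using True a by simp
      finally show ?thesis using True by simp
    qed (simp add: a)
    also have "\<dots> = (if Suc ((a + c i) mod M i) = M i then 0 else Suc ((a + c i) mod M i))"
      by (rule mod_Suc)
    finally show ?thesis
      using True assms(2) a by (auto simp: rotate_site_def tshift_def split: if_splits)
  next
    case False
    then show ?thesis by (simp add: rotate_site_def tshift_def)
  qed
qed

text \<open>A rotation permutes i.i.d. couplings, so it preserves quenched overlaps as soon as it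
  preserves the weights.\<close>

lemma q_overlap_rotate:
  assumes w: "\<And>b. b \<in> torus_bonds d M \<Longrightarrow> w (map_prod (rotate_site d M c) id b) = w b"
    and b: "b \<in> torus_bonds d M"
  shows "q_overlap (configs (lat_box d M)) (torus_bonds d M) (torus_spin M) w (map_prod (rotate_site d M c) id b)
    = q_overlap (configs (lat_box d M)) (torus_bonds d M) (torus_spin M) w b"
proof -
  let ?S = "lat_box d M" and ?r = "rotate_site d M c"
  let ?F = "\<lambda>\<sigma>. \<lambda>n\<in>?S. \<sigma> (inv_into ?S ?r n)"
  interpret T: spin_system "configs ?S" "torus_bonds d M" "torus_spin M"
    by (rule spin_system_torus)
  have r: "inj_on ?r ?S" "?r ` ?S = ?S" using bij_rotate_site by (auto simp: bij_betw_def)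
  have g: "inj_on (map_prod ?r id) (torus_bonds d M)"
    using r(1) unfolding torus_bonds_eq by (intro map_prod_inj_on) auto
  have image: "map_prod ?r id ` torus_bonds d M = torus_bonds d M"
    unfolding torus_bonds_eq using map_prod_surj_on[OF r(2), of id "{..<d}" "{..<d}"] by simp
  have F: "bij_betw ?F (configs ?S) (configs ?S)"
    by (rule bij_betw_configs[OF bij_rotate_site])
  have Fr: "?F \<sigma> (?r n) = \<sigma> n" if "n \<in> ?S" for \<sigma> n
    using that r by (auto simp: inv_into_f_f)
  have s: "torus_spin M (map_prod ?r id b) (?F \<sigma>) = torus_spin M b \<sigma>"
    if "b \<in> torus_bonds d M" "\<sigma> \<in> configs ?S" for b \<sigma>
  proof -
    have n: "fst b \<in> ?S" "tshift M (fst b) (snd b) \<in> ?S" "snd b < d"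
      using that(1) tshift_in_lat_box[of "fst b" d M "snd b"] by (auto simp: torus_bonds_def)
    have "torus_spin M (map_prod ?r id b) (?F \<sigma>)
        = ?F \<sigma> (?r (fst b)) * ?F \<sigma> (?r (tshift M (fst b) (snd b)))"
      using rotate_site_tshift[OF n(1,3)] by (simp add: bond_spin_def)
    also have "\<dots> = torus_spin M b \<sigma>"
      unfolding Fr[OF n(1)] Fr[OF n(2)] by (simp add: bond_spin_def)
    finally show ?thesis .
  qed
  show ?thesis
    using T.q_overlap_iso[where g = "map_prod ?r id" and F = ?F and w' = w and w = w, OF g F s w b]
    unfolding image .
qed

text \<open>Adding a multiple of \<open>l\<close> and reducing modulo a multiple of \<open>l\<close>
  both preserve divisibility by \<open>l\<close>. Hence block translations map crossing bonds to
  crossing bonds.\<close>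

lemma dvd_rotate:
  fixes l m a q :: nat
  assumes "1 \<le> a" "l dvd m"
  shows "l dvd (a - 1 + q * l) mod m + 1 \<longleftrightarrow> l dvd a"
proof -
  let ?x = "a - 1 + q * l"
  have "l dvd ?x mod m + 1 \<longleftrightarrow> l dvd (?x mod m + 1) + ?x div m * m"
    using assms(2) by (simp only: dvd_add_left_iff dvd_mult)
  also have "(?x mod m + 1) + ?x div m * m = ?x + 1"
    using mod_mult_div_eq by simp
  also have "\<dots> = a + q * l"
    using assms(1) by simp
  also have "l dvd a + q * l \<longleftrightarrow> l dvd a" by simp
  finally show ?thesis .
qed

lemma bdry_bonds_subset_stretch:
  assumes "\<forall>i<d. K i \<ge> 1"
  shows "bdry_bonds d L \<subseteq> torus_bonds d (stretch K L)"
proof -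
  have "n i \<le> stretch K L i" if "n i \<le> L i" "i < d" for n :: site and i
    using that assms mult_right_mono[of 1 "K i" "L i"] by (auto simp: stretch_def intro: order_trans)
  then show ?thesis
    by (auto simp: bdry_bonds_def torus_bonds_def lat_box_def)
qed

lemma q_overlap_translate:
  fixes K L :: "nat \<Rightarrow> nat"
  assumes K: "\<forall>i<d. K i \<ge> 1" and q: "q \<in> blocks d K" and b: "b \<in> bdry_bonds d L"
  defines "M \<equiv> stretch K L"
  shows "q_overlap (configs (lat_box d M)) (torus_bonds d M) (torus_spin M)
      (interp_weight (cross_bonds d K L) r) (translate_bond L q b)
    = q_overlap (configs (lat_box d M)) (torus_bonds d M) (torus_spin M)
      (interp_weight (cross_bonds d K L) r) b"
proof -
  let ?c = "\<lambda>i. q i * L i"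
  let ?g = "map_prod (rotate_site d M ?c) id :: bond \<Rightarrow> bond"
  \<comment> \<open>Starting in the first block, a block translation stays within the range of the
    torus coordinates, so the reduction modulo \<open>M i\<close> has no effect.\<close>
  have "translate L q (fst b) = rotate_site d M ?c (fst b)"
  proof
    fix i
    show "translate L q (fst b) i = rotate_site d M ?c (fst b) i"
    proof (cases "i < d")
      case True
      then have n: "1 \<le> fst b i" "fst b i \<le> L i"
        using b by (auto simp: bdry_bonds_def lat_box_def)
      then have "fst b i - 1 + q i * L i < M i"
        using blocks_le[of q d K i "fst b i" L] q True n(2) by (simp add: M_def stretch_def)
      then show ?thesis
        using True n by (simp add: translate_def rotate_site_def)
    next
      case False
      then show ?thesis
        using b blocks_zero[OF q] by (auto simp: translate_def rotate_site_def bdry_bonds_def lat_box_def)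
    qed
  qed
  then have "translate_bond L q b = ?g b"
    by (cases b) simp
  moreover have "interp_weight (cross_bonds d K L) r (?g b') = interp_weight (cross_bonds d K L) r b'"
    if b': "b' \<in> torus_bonds d M" for b'
  proof -
    have "?g b' \<in> torus_bonds d M"
      using b' bij_betwE[OF bij_rotate_site[of d M ?c]] by (auto simp: torus_bonds_eq)
    moreover have "L (snd b') dvd rotate_site d M ?c (fst b') (snd b') \<longleftrightarrow> L (snd b') dvd fst b' (snd b')"
      using b' dvd_rotate[of "fst b' (snd b')" "L (snd b')" "M (snd b')" "q (snd b')"]
      by (auto simp: rotate_site_def M_def stretch_def torus_bonds_def lat_box_def)
    ultimately show ?thesis
      using b' by (simp add: interp_weight_def cross_bonds_def M_def[symmetric])
  qed
  ultimately show ?thesis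
    using q_overlap_rotate[of d M "interp_weight (cross_bonds d K L) r" ?c b]
      bdry_bonds_subset_stretch[OF K, of L] b
    by (auto simp: M_def)
qed

lemma sum_cross_bonds_q_overlap:
  fixes K L :: "nat \<Rightarrow> nat" and Q :: "real \<Rightarrow> bond \<Rightarrow> real"
  assumes L: "\<forall>i<d. L i \<ge> 1" and K: "\<forall>i<d. K i \<ge> 1"
  defines "M \<equiv> stretch K L"
  defines "Q \<equiv> \<lambda>r. q_overlap (configs (lat_box d M)) (torus_bonds d M) (torus_spin M)
      (interp_weight (cross_bonds d K L) r)"
  shows "(\<Sum>b\<in>cross_bonds d K L. 1 - Q r b) = card (blocks d K) * (\<Sum>b\<in>bdry_bonds d L. 1 - Q r b)"
proof -
  have "(\<Sum>b\<in>cross_bonds d K L. 1 - Q r b)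
      = (\<Sum>q\<in>blocks d K. \<Sum>b\<in>translate_bond L q ` bdry_bonds d L. 1 - Q r b)"
    unfolding cross_bonds_blocks(1)[OF L]
    using disjoint_translate_bond[OF bdry_bonds_subset]
    by (intro sum.UNION_disjoint) (auto simp: finite_blocks finite_bdry_bonds disjoint_family_on_def)
  also have "\<dots> = (\<Sum>q\<in>blocks d K. \<Sum>b\<in>bdry_bonds d L. 1 - Q r b)"
  proof (rule sum.cong)
    fix q assume q: "q \<in> blocks d K"
    have "(\<Sum>b\<in>translate_bond L q ` bdry_bonds d L. 1 - Q r b)
        = (\<Sum>b\<in>bdry_bonds d L. 1 - Q r (translate_bond L q b))"
      by (subst sum.reindex) (auto intro: inj_on_subset[OF inj_translate_bond])
    also have "\<dots> = (\<Sum>b\<in>bdry_bonds d L. 1 - Q r b)"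
      using q_overlap_translate[OF K q] by (intro sum.cong) (auto simp: Q_def M_def)
    finally show "(\<Sum>b\<in>translate_bond L q ` bdry_bonds d L. 1 - Q r b) = (\<Sum>b\<in>bdry_bonds d L. 1 - Q r b)" .
  qed simp
  finally show ?thesis by simp
qed

subsection \<open>The surface pressure\<close>

lemma magnify_eq_stretch: "magnify k L = stretch (\<lambda>_. k) L"
  by (simp add: magnify_def stretch_def fun_eq_iff)

text \<open>Given the couplings, the two replicas are independent with the same law, so a product
  observable factorizes.\<close>

lemma replica_average:
  "(\<Sum>\<sigma>\<in>C. \<Sum>\<tau>\<in>C. (f \<sigma> * f \<tau>) * exp (energy B s x \<sigma> + energy B s x \<tau>)) / (partf C B s x)\<^sup>2
    = (gibbs C B s x f)\<^sup>2"
proof -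
  have "(\<Sum>\<sigma>\<in>C. \<Sum>\<tau>\<in>C. (f \<sigma> * f \<tau>) * exp (energy B s x \<sigma> + energy B s x \<tau>))
      = (\<Sum>\<sigma>\<in>C. f \<sigma> * exp (energy B s x \<sigma>)) * (\<Sum>\<tau>\<in>C. f \<tau> * exp (energy B s x \<tau>))"
    unfolding sum_product by (simp add: exp_add mult_ac)
  then show ?thesis
    by (simp add: gibbs_def power_divide power2_eq_square)
qed

lemma quenched_q_bdry:
  fixes L :: "nat \<Rightarrow> nat" and k :: nat
  assumes k: "k \<ge> 1"
  defines "M \<equiv> stretch (\<lambda>_. k) L"
  shows "quenched_t d L k t (q_bdry d L k) = (\<Sum>b\<in>bdry_bonds d L.
      q_overlap (configs (lat_box d M)) (torus_bonds d M) (torus_spin M)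
        (interp_weight (cross_bonds d (\<lambda>_. k) L) (sqrt t)) b) / card (bdry_bonds d L)"
proof -
  let ?C = "configs (lat_box d M)" and ?B = "torus_bonds d M" and ?s = "torus_spin M"
  let ?w = "interp_weight (cross_bonds d (\<lambda>_. k) L) (sqrt t)"
  let ?c = "real (card (bdry_bonds d L))"
  interpret T: spin_system ?C ?B ?s by (rule spin_system_torus)
  have sub: "bdry_bonds d L \<subseteq> ?B"
    unfolding M_def by (rule bdry_bonds_subset_stretch) (use k in simp)
  \<comment> \<open>The factor \<open>sqrt (tweight L t b)\<close> is \<open>sqrt t\<close> on
    crossing bonds and \<open>sqrt 1 = 1\<close> elsewhere, which is \<open>interp_weight\<close> at
    \<open>sqrt t\<close>.\<close>
  have U: "U_t d L k t J = energy ?B ?s (\<lambda>b. ?w b * J b)" for J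
  proof
    fix \<sigma>
    show "U_t d L k t J \<sigma> = energy ?B ?s (\<lambda>b. ?w b * J b) \<sigma>"
      unfolding U_t_def energy_def magnify_eq_stretch M_def[symmetric]
      by (intro sum.cong refl)
         (auto simp: tweight_def interp_weight_def cross_bonds_def bond_spin_def M_def)
  qed
  have q: "q_bdry d L k \<sigma> \<tau> = (\<Sum>b\<in>bdry_bonds d L. ?s b \<sigma> * ?s b \<tau>) / ?c" for \<sigma> \<tau>
    by (simp add: q_bdry_def bond_spin_def magnify_eq_stretch M_def mult.assoc)
  have "omega_t d L k t J (q_bdry d L k)
      = (\<Sum>b\<in>bdry_bonds d L. (gibbs ?C ?B ?s (\<lambda>b. ?w b * J b) (?s b))\<^sup>2) / ?c" for J
  proof -
    let ?E = "energy ?B ?s (\<lambda>b. ?w b * J b)" and ?Z = "partf ?C ?B ?s (\<lambda>b. ?w b * J b)"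
    have "(\<Sum>\<sigma>\<in>?C. \<Sum>\<tau>\<in>?C. q_bdry d L k \<sigma> \<tau> * exp (?E \<sigma> + ?E \<tau>))
        = (\<Sum>\<sigma>\<in>?C. \<Sum>\<tau>\<in>?C. \<Sum>b\<in>bdry_bonds d L. ?s b \<sigma> * ?s b \<tau> * exp (?E \<sigma> + ?E \<tau>)) / ?c"
      by (simp add: q sum_divide_distrib sum_distrib_right)
    also have "\<dots> = (\<Sum>b\<in>bdry_bonds d L. \<Sum>\<sigma>\<in>?C. \<Sum>\<tau>\<in>?C. ?s b \<sigma> * ?s b \<tau> * exp (?E \<sigma> + ?E \<tau>)) / ?c"
      by (simp add: sum.swap[of _ "bdry_bonds d L"])
    finally have "omega_t d L k t J (q_bdry d L k) = (\<Sum>b\<in>bdry_bonds d L.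
        (\<Sum>\<sigma>\<in>?C. \<Sum>\<tau>\<in>?C. ?s b \<sigma> * ?s b \<tau> * exp (?E \<sigma> + ?E \<tau>)) / ?Z\<^sup>2) / ?c"
      unfolding omega_t_def U magnify_eq_stretch M_def[symmetric]
      by (simp add: partf_def sum_divide_distrib mult_ac)
    then show ?thesis
      by (simp only: replica_average)
  qed
  then have "quenched_t d L k t (q_bdry d L k)
      = gauss_av ?B (\<lambda>J. (\<Sum>b\<in>bdry_bonds d L. (gibbs ?C ?B ?s (\<lambda>b. ?w b * J b) (?s b))\<^sup>2) / ?c)"
    by (simp add: quenched_t_def magnify_eq_stretch M_def)
  also have "\<dots> = (\<Sum>b\<in>bdry_bonds d L. q_overlap ?C ?B ?s ?w b) / ?c"
    using sub unfolding gauss_av_def q_overlap_def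
    by (subst integral_divide_zero, subst Bochner_Integration.integral_sum)
       (auto intro: T.integrable_gibbs_square)
  finally show ?thesis .
qed

lemma overlap_integral_eq:
  fixes L :: "nat \<Rightarrow> nat"
  assumes d: "d \<ge> 1" and L: "\<forall>i<d. L i \<ge> 1" and k: "k \<ge> 1"
  defines "N \<equiv> real (card (blocks d (\<lambda>_. k)))" and "c \<equiv> real (card (bdry_bonds d L))"
  shows "integral {0..1} (\<lambda>t. 1 - quenched_t d L k t (q_bdry d L k))
    = (P_torus d (stretch (\<lambda>_. k) L) / N - P_free d L) * (2 / c)"
proof -
  let ?M = "stretch (\<lambda>_. k) L" and ?D = "cross_bonds d (\<lambda>_. k) L"
  let ?Q = "\<lambda>r. q_overlap (configs (lat_box d ?M)) (torus_bonds d ?M) (torus_spin ?M)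
    (interp_weight ?D r)"
  let ?q = "\<lambda>t. quenched_t d L k t (q_bdry d L k)"
  interpret T: spin_system "configs (lat_box d ?M)" "torus_bonds d ?M" "torus_spin ?M"
    by (rule spin_system_torus)
  have N: "N > 0"
    using card_blocks_pos[of d "\<lambda>_. k"] k by (simp add: N_def)
  have c: "c > 0"
    using card_bdry_bonds_pos[OF d L] by (simp add: c_def)
  have one: "interp_weight ?D 1 = (\<lambda>_. 1)"
    by (simp add: interp_weight_def fun_eq_iff)
  \<comment> \<open>The 1/2 comes from the interpolation, \<open>N\<close> from translating every
    block to the first one, and \<open>c\<close> from the normalization of
    \<open>q_bdry\<close>.\<close>
  have "(\<Sum>b\<in>?D. 1 - ?Q (sqrt t) b) / 2 = N * c / 2 * (1 - ?q t)" for t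
  proof -
    have "(\<Sum>b\<in>?D. 1 - ?Q (sqrt t) b) = N * (\<Sum>b\<in>bdry_bonds d L. 1 - ?Q (sqrt t) b)"
      unfolding N_def by (rule sum_cross_bonds_q_overlap[OF L]) (use k in simp)
    also have "(\<Sum>b\<in>bdry_bonds d L. 1 - ?Q (sqrt t) b) = c * (1 - ?q t)"
      unfolding quenched_q_bdry[OF k] using c by (simp add: c_def sum_subtractf right_diff_distrib)
    finally show ?thesis by simp
  qed
  moreover note T.q_pressure_interpolation[OF cross_bonds_subset]
  ultimately have "((\<lambda>t. N * c / 2 * (1 - ?q t)) has_integral P_torus d ?M - N * P_free d L) {0..1}"
    by (simp add: one P_torus_def[symmetric] q_pressure_torus_cut[OF L] N_def)
  then have "((\<lambda>t. 2 / (N * c) * (N * c / 2 * (1 - ?q t)))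
      has_integral 2 / (N * c) * (P_torus d ?M - N * P_free d L)) {0..1}"
    by (rule has_integral_mult_right)
  moreover have "2 / (N * c) * (N * c / 2 * x) = x" for x
    using N c by simp
  ultimately have "integral {0..1} (\<lambda>t. 1 - ?q t) = 2 / (N * c) * (P_torus d ?M - N * P_free d L)"
    by (simp only: integral_unique)
  also have "\<dots> = (P_torus d ?M / N - P_free d L) * (2 / c)"
    using N c by (simp add: field_simps)
  finally show ?thesis .
qed

theorem theorem1:
  fixes d :: nat and L :: "nat \<Rightarrow> nat"
  assumes "d \<ge> 1" and "\<forall>i<d. L i \<ge> 1"
  shows "(\<exists>l. (\<lambda>k. integral {0..1} (\<lambda>t. 1 - quenched_t d L k t (q_bdry d L k))) \<longlonglongrightarrow> l
            \<and> surface_pressure d L = - (real (surface d L) / 4) * l)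
         \<and> - 1 / 4 \<le> surface_pressure d L / real (surface d L)
         \<and> surface_pressure d L / real (surface d L) \<le> 0"
proof -
  let ?I = "\<lambda>k. integral {0..1} (\<lambda>t. 1 - quenched_t d L k t (q_bdry d L k))"
  let ?N = "\<lambda>k. real (card (blocks d (\<lambda>_. k)))" and ?P = "\<lambda>k. P_torus d (stretch (\<lambda>_. k) L)"
  define c where "c = real (card (bdry_bonds d L))"
  have c: "c > 0"
    using card_bdry_bonds_pos[OF assms] by (simp add: c_def)
  define l where "l = (pressure d * card (lat_box d L) - P_free d L) * (2 / c)"
  \<comment> \<open>For \<open>k = 0\<close> the torus is empty; the limit only sees
    \<open>k \<ge> 1\<close>.\<close>
  have I: "?I k = (?P k / ?N k - P_free d L) * (2 / c)" if "k \<ge> 1" for k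
    unfolding c_def by (rule overlap_integral_eq[OF assms that])
  have "(\<lambda>k. (?P k / ?N k - P_free d L) * (2 / c)) \<longlonglongrightarrow> l"
    unfolding l_def by (intro tendsto_intros P_torus_density_tendsto_pressure[OF assms(2)])
  then have lim: "?I \<longlonglongrightarrow> l"
    by (rule Lim_transform_eventually, intro eventually_sequentiallyI[of 1]) (simp only: I)
  \<comment> \<open>The cut estimate bounds the integral at every such \<open>k\<close>, and the
    bounds pass to the limit.\<close>
  have bounds: "0 \<le> ?I k" "?I k \<le> 1" if k: "k \<ge> 1" for k
  proof -
    have N: "?N k > 0" using card_blocks_pos[of d "\<lambda>_. k"] k by simp
    have "?N k * P_free d L \<le> ?P k" "?P k \<le> ?N k * P_free d L + ?N k * c / 2"
      using P_torus_bounds[OF assms(2), of "\<lambda>_. k"] by (simp_all add: c_def)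
    then have "P_free d L \<le> ?P k / ?N k" "?P k / ?N k \<le> P_free d L + c / 2"
      using N by (simp_all add: field_simps)
    then show "0 \<le> ?I k" "?I k \<le> 1"
      using c by (simp_all add: I[OF k] field_simps)
  qed
  have l: "0 \<le> l" "l \<le> 1"
    using bounds LIMSEQ_le_const[OF lim] LIMSEQ_le_const2[OF lim] by blast+
  \<comment> \<open>A quarter of \<open>surface\<close> is \<open>c / 2\<close>, which cancels the
    factor \<open>2 / c\<close> in \<open>l\<close>.\<close>
  have T: "surface_pressure d L = - (real (surface d L) / 4) * l"
    using c by (simp add: surface_pressure_def surface_eq_card_bdry_bonds[OF assms(2)] l_def c_def field_simps)
  moreover have "surface_pressure d L / real (surface d L) = - l / 4"
    using c unfolding T by (simp add: surface_eq_card_bdry_bonds[OF assms(2)] c_def)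
  ultimately show ?thesis
    using lim l by auto
qed

end
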